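(* Let $(X,d,\mu)$ be a complete metric measure space with $\mu$ doubling, and suppose that $X$ supports a weak $(1,1)$-Poincaré inequality. Let $\nu$ be a Borel regular outer measure on $X$ and let $1\le q<\infty$. If there is a constant $\gamma$ such that $$\nu(B)^{1/q}\le\gamma\,\operatorname{cap}_1(B,X)\quad\text{for every ball } B\subset X,$$ then there is a constant $c_S$, independent of $u$, such that $$\left(\int_X|u|^q\,d\nu\right)^{1/q}\le c_S\int_X g_u\,d\mu$$ for every $u\in N^{1,1}(X)\cap C_0(X)$ and every $1$-weak upper gradient $g_u$ of $u$.
   Context: $(X,d)$ is a metric space and $\mu$ is a Borel regular outer measure on $X$ with $0<\mu(B)<\infty$ for every ball $B=B(x,r)=\{y\in X: d(x,y)<r\}$. The measure $\mu$ is doubling if there is $c_D\ge1$ with $\mu(B(x,2r))\le c_D\,\mu(B(x,r))$ for all $x\in X$, $r>0$. A path is a rectifiable non-constant continuous map from a compact interval to $X$. A family $\Gamma$ of paths has zero $1$-modulus if there is a non-negative Borel function $\rho\in L^1(X)$ with $\int_\gamma\rho\,ds=\infty$ for all $\gamma\in\Gamma$; a property holds for $1$-almost every path if the family of paths for which it fails has zero $1$-modulus. A non-negative Borel function $g$ on $X$ is an upper gradient of an extended real-valued function $u$ on $X$ if for all paths $\gamma$, with endpoints $x,y$, one has $|u(x)-u(y)|\le\int_\gamma g\,ds$ whenever $u(x),u(y)$ are both finite, and $\int_\gamma g\,ds=\infty$ otherwise; a non-negative measurable function $g$ is a $1$-weak upper gradient of $u$ if this condition holds for $1$-almost every path. $N^{1,1}(X)$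 is the space of $u\in L^1(X)$ with $\|u\|_{N^{1,1}(X)}=\int_X|u|\,d\mu+\inf_g\int_X g\,d\mu<\infty$ (infimum over $1$-weak upper gradients $g$ of $u$), modulo $u\sim v$ iff $\|u-v\|_{N^{1,1}(X)}=0$. $C_0(X)$ is the space of continuous real-valued functions on $X$ with compact support. $X$ supports a weak $(1,1)$-Poincaré inequality if there are constants $c_p>0$ and $\tau\ge1$ such that for all balls $B(x,r)$, all integrable $u$ on $X$ and all upper gradients $g_u$ of $u$, $$\frac1{\mu(B(x,r))}\int_{B(x,r)}|u-u_{B(x,r)}|\,d\mu\le c_p\,r\,\frac1{\mu(B(x,\tau r))}\int_{B(x,\tau r)}g_u\,d\mu,\qquad u_B=\frac1{\mu(B)}\int_B u\,d\mu.$$ For $E\subset X$, $\operatorname{cap}_1(E,X)=\inf\int_X g_u\,d\mu$, where the infimum is over all continuous functions $u\in N^{1,1}(X)$ with $u=1$ on $E$ and all $1$-weak upper gradients $g_u$ of $u$; it is $\infty$ if there are no such functions. *)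

theory Defs
  imports "HOL-Analysis.Analysis"
begin

section \<open>Borel regular outer measures\<close>

definition borel_regular :: "('a::topological_space set \<Rightarrow> ennreal) \<Rightarrow> bool" where
  "borel_regular \<mu> \<longleftrightarrow>
     outer_measure_space (Pow UNIV) \<mu> \<and>
     sets borel \<subseteq> lambda_system UNIV (Pow UNIV) \<mu> \<and>
     (\<forall>A. \<exists>B\<in>sets borel. A \<subseteq> B \<and> \<mu> B = \<mu> A)"

text \<open>Integrals with respect to an outer measure are taken over its Caratheodory measurable sets;
  measurable means measurable with respect to this (complete) sigma-algebra.\<close>

definition carath :: "('a set \<Rightarrow> ennreal) \<Rightarrow> 'a measure" where
  "carath \<mu> = measure_of UNIV (lambda_system UNIV (Pow UNIV) \<mu>) \<mu>"

lemma
  assumes "outer_measure_space (Pow UNIV) \<mu>"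
  shows space_carath: "space (carath \<mu>) = UNIV"
    and sets_carath: "sets (carath \<mu>) = lambda_system UNIV (Pow UNIV) \<mu>"
    and emeasure_carath: "A \<in> lambda_system UNIV (Pow UNIV) \<mu> \<Longrightarrow> emeasure (carath \<mu>) A = \<mu> A"
proof -
  have ms: "measure_space UNIV (lambda_system UNIV (Pow UNIV) \<mu>) \<mu>"
    using sigma_algebra.caratheodory_lemma[OF sigma_algebra_Pow assms] by simp
  then interpret sigma_algebra UNIV "lambda_system UNIV (Pow UNIV) \<mu>"
    by (simp add: measure_space_def)
  show "space (carath \<mu>) = UNIV"
    by (simp add: carath_def space_measure_of_conv)
  show "sets (carath \<mu>) = lambda_system UNIV (Pow UNIV) \<mu>"
    unfolding carath_def by (rule sets_measure_of_eq)
  show "emeasure (carath \<mu>) A = \<mu> A" if "A \<in> lambda_system UNIV (Pow UNIV) \<mu>"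
    using ms that unfolding carath_def measure_space_def
    by (intro emeasure_measure_of_sigma) simp_all
qed

definition doubling :: "('a::metric_space set \<Rightarrow> ennreal) \<Rightarrow> bool" where
  "doubling \<mu> \<longleftrightarrow> (\<exists>cD::real. 1 \<le> cD \<and>
     (\<forall>x r. 0 < r \<longrightarrow> \<mu> (ball x (2 * r)) \<le> ennreal cD * \<mu> (ball x r)))"

text \<open>Powers of extended non-negative numbers, for positive exponents \<open>p\<close>.\<close>

definition ennpowr :: "ennreal \<Rightarrow> real \<Rightarrow> ennreal" where
  "ennpowr x p = (if x = \<infinity> then \<infinity> else ennreal (enn2real x powr p))"

section \<open>Paths and line integrals\<close>

text \<open>A path is given by a map \<open>p\<close> together with the end points of its parameter
  interval \<open>{a..b}\<close>; values of \<open>p\<close> outside this interval are irrelevant.\<close>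

definition path_length :: "(real \<Rightarrow> 'a::metric_space) \<Rightarrow> real \<Rightarrow> real \<Rightarrow> ennreal" where
  "path_length p a b =
     (SUP ts\<in>{ts. sorted ts \<and> set ts \<subseteq> {a..b}}.
        \<Sum>i<length ts - 1. ennreal (dist (p (ts ! i)) (p (ts ! Suc i))))"

definition rect_path :: "(real \<Rightarrow> 'a::metric_space) \<Rightarrow> real \<Rightarrow> real \<Rightarrow> bool" where
  "rect_path p a b \<longleftrightarrow>
     a \<le> b \<and> continuous_on {a..b} p \<and> path_length p a b < \<infinity> \<and> \<not> p constant_on {a..b}"

text \<open>Arc length parametrization of a rectifiable path, on \<open>[0, path_length p a b]\<close>. A parameter
  \<open>t\<close> as below exists by continuity of the length function, and \<open>p t\<close> does not depend
  on its choice.\<close>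

definition arc_param :: "(real \<Rightarrow> 'a::metric_space) \<Rightarrow> real \<Rightarrow> real \<Rightarrow> real \<Rightarrow> 'a" where
  "arc_param p a b s = p (SOME t. t \<in> {a..b} \<and> path_length p a t = ennreal s)"

definition line_integral ::
    "('a::metric_space \<Rightarrow> ennreal) \<Rightarrow> (real \<Rightarrow> 'a) \<Rightarrow> real \<Rightarrow> real \<Rightarrow> ennreal" where
  "line_integral \<rho> p a b =
     (\<integral>\<^sup>+ s\<in>{0..enn2real (path_length p a b)}. \<rho> (arc_param p a b s) \<partial>lebesgue)"

section \<open>Modulus and upper gradients\<close>

definition zero_modulus ::
    "('a::metric_space set \<Rightarrow> ennreal) \<Rightarrow> ((real \<Rightarrow> 'a) \<times> real \<times> real) set \<Rightarrow> bool" where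
  "zero_modulus \<mu> \<Gamma> \<longleftrightarrow>
     (\<exists>\<rho>\<in>borel_measurable borel. (\<integral>\<^sup>+ x. \<rho> x \<partial>carath \<mu>) < \<infinity> \<and>
        (\<forall>(p, a, b)\<in>\<Gamma>. line_integral \<rho> p a b = \<infinity>))"

definition upper_gradient_on_path ::
    "('a::metric_space \<Rightarrow> ereal) \<Rightarrow> ('a \<Rightarrow> ennreal) \<Rightarrow> (real \<Rightarrow> 'a) \<Rightarrow> real \<Rightarrow> real \<Rightarrow> bool" where
  "upper_gradient_on_path u g p a b \<longleftrightarrow>
     (if \<bar>u (p a)\<bar> \<noteq> \<infinity> \<and> \<bar>u (p b)\<bar> \<noteq> \<infinity>
      then e2ennreal \<bar>u (p a) - u (p b)\<bar> \<le> line_integral g p a b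
      else line_integral g p a b = \<infinity>)"

definition upper_gradient :: "('a::metric_space \<Rightarrow> ereal) \<Rightarrow> ('a \<Rightarrow> ennreal) \<Rightarrow> bool" where
  "upper_gradient u g \<longleftrightarrow>
     g \<in> borel_measurable borel \<and>
     (\<forall>p a b. rect_path p a b \<longrightarrow> upper_gradient_on_path u g p a b)"

text \<open>For measurable \<open>g\<close>, the composition of \<open>g\<close> with the arc length parametrization is Lebesgue
  measurable for 1-almost every path, so the values of \<open>line_integral g\<close> on the remaining paths
  do not matter here.\<close>

definition weak_upper_gradient ::
    "('a::metric_space set \<Rightarrow> ennreal) \<Rightarrow> ('a \<Rightarrow> ereal) \<Rightarrow> ('a \<Rightarrow> ennreal) \<Rightarrow> bool" where
  "weak_upper_gradient \<mu> u g \<longleftrightarrow>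
     g \<in> borel_measurable (carath \<mu>) \<and>
     zero_modulus \<mu> {(p, a, b). rect_path p a b \<and> \<not> upper_gradient_on_path u g p a b}"

section \<open>Function spaces, Poincare inequality and capacity\<close>

definition L1 :: "('a set \<Rightarrow> ennreal) \<Rightarrow> ('a \<Rightarrow> ereal) set" where
  "L1 \<mu> = {u \<in> borel_measurable (carath \<mu>). (\<integral>\<^sup>+ x. e2ennreal \<bar>u x\<bar> \<partial>carath \<mu>) < \<infinity>}"

definition N11_norm :: "('a::metric_space set \<Rightarrow> ennreal) \<Rightarrow> ('a \<Rightarrow> ereal) \<Rightarrow> ennreal" where
  "N11_norm \<mu> u =
     (\<integral>\<^sup>+ x. e2ennreal \<bar>u x\<bar> \<partial>carath \<mu>) +
     (INF g\<in>{g. weak_upper_gradient \<mu> u g}. \<integral>\<^sup>+ x. g x \<partial>carath \<mu>)"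

text \<open>The functions representing elements of the Newtonian space. The quotient by functions of
  norm zero is not formed, since membership of concrete (continuous) functions and their
  1-weak upper gradients are all that is needed.\<close>

definition N11 :: "('a::metric_space set \<Rightarrow> ennreal) \<Rightarrow> ('a \<Rightarrow> ereal) set" where
  "N11 \<mu> = {u \<in> L1 \<mu>. N11_norm \<mu> u < \<infinity>}"

definition C0 :: "('a::metric_space \<Rightarrow> real) set" where
  "C0 = {u. continuous_on UNIV u \<and> compact (closure {x. u x \<noteq> 0})}"

text \<open>Functions in \<open>L1\<close> are finite almost everywhere, so their mean values may be computed
  from \<open>real_of_ereal\<close>.\<close>

definition mean_value :: "('a set \<Rightarrow> ennreal) \<Rightarrow> 'a set \<Rightarrow> ('a \<Rightarrow> ereal) \<Rightarrow> real" where
  "mean_value \<mu> B u = (LINT x:B|carath \<mu>. real_of_ereal (u x)) / measure (carath \<mu>) B"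

definition weak_11_Poincare :: "('a::metric_space set \<Rightarrow> ennreal) \<Rightarrow> bool" where
  "weak_11_Poincare \<mu> \<longleftrightarrow>
     (\<exists>cp \<tau>::real. 0 < cp \<and> 1 \<le> \<tau> \<and>
       (\<forall>x r u g. 0 < r \<longrightarrow> u \<in> L1 \<mu> \<longrightarrow> upper_gradient u g \<longrightarrow>
          (\<integral>\<^sup>+ y\<in>ball x r. e2ennreal \<bar>u y - ereal (mean_value \<mu> (ball x r) u)\<bar> \<partial>carath \<mu>)
             / \<mu> (ball x r)
          \<le> ennreal (cp * r) *
             ((\<integral>\<^sup>+ y\<in>ball x (\<tau> * r). g y \<partial>carath \<mu>) / \<mu> (ball x (\<tau> * r)))))"

definition cap1 :: "('a::metric_space set \<Rightarrow> ennreal) \<Rightarrow> 'a set \<Rightarrow> ennreal" where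
  "cap1 \<mu> E =
     (INF (u, g)\<in>{(u :: 'a \<Rightarrow> real, g). continuous_on UNIV u \<and> (\<lambda>x. ereal (u x)) \<in> N11 \<mu> \<and>
          (\<forall>x\<in>E. u x = 1) \<and> weak_upper_gradient \<mu> (\<lambda>x. ereal (u x)) g}.
        \<integral>\<^sup>+ x. g x \<partial>carath \<mu>)"

end

theory Submission
  imports Defs
begin

text \<open>
  The classical proof combines the coarea formula for BV functions with a boxing inequality for
  sets of finite perimeter. Here both are replaced by one elementary argument about truncations.

  By Cavalieri's principle on dyadic levels it suffices to bound \<open>\<nu>\<close> on each superlevel set
  \<open>K = {f \<ge> 2 \<alpha>}\<close> of \<open>f = \<bar>u\<bar>\<close> by the energy \<open>\<integral> g d\<mu>\<close> over \<open>{\<alpha> \<le> f \<le> 3/2 \<alpha>}\<close>. These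
  level strips are disjoint for different dyadic \<open>\<alpha>\<close>, and since \<open>q \<ge> 1\<close> the inequality
  \<open>\<Sum> a\<^sub>k\<^sup>q \<le> (\<Sum> a\<^sub>k)\<^sup>q\<close> sums the levels (\<open>capacitary_strong_type\<close>).

  For a single level, many disjoint thin slabs are chosen in the strip. By pigeonhole one of them
  carries at most twice its fair share of energy and has so little measure that it fills at most
  half of every ball centred in \<open>K\<close> of some fixed small radius (\<open>level_estimate\<close>). Let \<open>v\<close> be
  the truncation of \<open>f\<close> to this slab, rescaled to have values in \<open>[0, 1]\<close>. Up to a set of small
  measure \<open>v\<close> is an indicator function, so it can play the part of a set of finite perimeter:
  around each point of \<open>K\<close> there is a ball on which the mean value of \<open>v\<close> stays away from both
  \<open>0\<close> and \<open>1\<close>, and the Poincare inequality, on the ball enlarged by its factor \<open>\<tau>\<close>, bounds the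
  ratio of measure and radius by the energy of \<open>v\<close> (\<open>boxing_radius\<close>). Such a ball exists because
  \<open>v\<close> is integrable and \<open>\<mu>(X) = \<infinity>\<close>; if \<open>\<mu>(X) < \<infinity>\<close>, then the constant \<open>1\<close> is admissible for the
  capacity of every ball, so \<open>\<nu> = 0\<close>. By Vitali's covering lemma disjoint balls of this kind have
  enlargements covering \<open>K\<close>, and the capacity of a ball is controlled by the ratio of its measure
  and radius (\<open>slab_estimate\<close>).

  Two facts about upper gradients carry the argument: a weak upper gradient can be replaced by a
  Borel upper gradient with almost the same integral (\<open>weak_upper_gradient_approx\<close>), and
  truncation to levels \<open>[\<alpha>, \<beta>]\<close> restricts an upper gradient to \<open>{\<alpha> \<le> u \<le> \<beta>}\<close>
  (\<open>upper_gradient_truncation\<close>). The latter needs line integrals over subpaths to be restrictions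
  of line integrals over the path, hence the continuity of the arc length function.
\<close>
section \<open>Length and arc length parametrization of rectifiable paths\<close>

definition partition_sum :: "(real \<Rightarrow> 'a::metric_space) \<Rightarrow> real list \<Rightarrow> ennreal" where
  "partition_sum p ts = (\<Sum>i<length ts - 1. ennreal (dist (p (ts ! i)) (p (ts ! Suc i))))"

lemma path_length_SUP:
  "path_length p a b = (SUP ts\<in>{ts. sorted ts \<and> set ts \<subseteq> {a..b}}. partition_sum p ts)"
  by (simp add: path_length_def partition_sum_def)

lemma partition_sum_le_path_length:
  "sorted ts \<Longrightarrow> set ts \<subseteq> {a..b} \<Longrightarrow> partition_sum p ts \<le> path_length p a b"
  unfolding path_length_SUP by (rule SUP_upper) auto

lemma dist_le_path_length:
  assumes "a \<le> b"
  shows "ennreal (dist (p a) (p b)) \<le> path_length p a b"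
  using partition_sum_le_path_length[of "[a, b]" a b p] assms by (simp add: partition_sum_def)

lemma path_length_mono: "a' \<le> a \<Longrightarrow> b \<le> b' \<Longrightarrow> path_length p a b \<le> path_length p a' b'"
  unfolding path_length_SUP by (rule SUP_subset_mono) auto

lemma path_length_add_ge:
  assumes "a \<le> b" "b \<le> c"
  shows "path_length p a b + path_length p b c \<le> path_length p a c"
proof -
  have append: "partition_sum p ts + partition_sum p us \<le> path_length p a c"
    if ts: "sorted ts" "set ts \<subseteq> {a..b}" and us: "sorted us" "set us \<subseteq> {b..c}" for ts us
  proof -
    let ?f = "\<lambda>i. ennreal (dist (p ((ts @ us) ! i)) (p ((ts @ us) ! Suc i)))"
    have "partition_sum p ts = sum ?f {..<length ts - 1}"
      unfolding partition_sum_def by (rule sum.cong) (auto simp: nth_append)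
    moreover have "partition_sum p us = sum ?f ((\<lambda>i. length ts + i) ` {..<length us - 1})"
      unfolding partition_sum_def
      by (subst sum.reindex) (auto simp: nth_append intro!: sum.cong)
    ultimately have "partition_sum p ts + partition_sum p us
        = sum ?f ({..<length ts - 1} \<union> (\<lambda>i. length ts + i) ` {..<length us - 1})"
      by (subst sum.union_disjoint) auto
    also have "\<dots> \<le> partition_sum p (ts @ us)"
      unfolding partition_sum_def by (rule sum_mono2) auto
    also have "\<dots> \<le> path_length p a c"
    proof (rule partition_sum_le_path_length)
      show "sorted (ts @ us)"
        using ts us by (fastforce simp: sorted_append)
      show "set (ts @ us) \<subseteq> {a..c}" using ts us assms by fastforce
    qed
    finally show ?thesis .
  qed
  have ne: "{ts. sorted ts \<and> set ts \<subseteq> {x..y}} \<noteq> {}" for x y :: real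
    by (auto intro!: exI[of _ "[]"])
  have "path_length p a b + partition_sum p us \<le> path_length p a c"
    if "sorted us" "set us \<subseteq> {b..c}" for us
    unfolding path_length_SUP[of p a b]
    by (auto simp: ennreal_SUP_add_left[OF ne, symmetric] intro!: SUP_least append that)
  then show ?thesis
    unfolding path_length_SUP[of p b c]
    by (subst ennreal_SUP_add_right[OF ne])
      (auto intro!: SUP_least)
qed

text \<open>Clamping the points of a partition to the left and to the right half of the interval
  gives partitions of the two halves; the interval of the partition that contains the splitting
  point is handled by the triangle inequality.\<close>
lemma path_length_add_le:
  assumes "a \<le> b" "b \<le> c"
  shows "path_length p a c \<le> path_length p a b + path_length p b c"
  unfolding path_length_SUP[of p a c]
proof (rule SUP_least, safe)
  fix ts assume ts: "sorted ts" "set ts \<subseteq> {a..c}"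
  have split: "ennreal (dist (p x) (p y)) \<le>
      ennreal (dist (p (min b x)) (p (min b y))) + ennreal (dist (p (max b x)) (p (max b y)))"
    if "x \<le> y" for x y
    using that by (cases "x \<le> b"; cases "y \<le> b")
      (auto simp: min_def max_def ennreal_plus[symmetric] dist_triangle simp del: ennreal_plus)
  have "partition_sum p ts \<le> partition_sum p (map (min b) ts) + partition_sum p (map (max b) ts)"
    unfolding partition_sum_def length_map sum.distrib[symmetric]
    using ts by (intro sum_mono) (auto intro!: split sorted_nth_mono)
  also have "\<dots> \<le> path_length p a b + path_length p b c"
  proof (intro add_mono partition_sum_le_path_length)
    show "sorted (map (min b) ts)" "sorted (map (max b) ts)"
      using ts(1) by (auto intro!: sorted_map_mono mono_onI simp: min_def max_def)
    show "set (map (min b) ts) \<subseteq> {a..b}" "set (map (max b) ts) \<subseteq> {b..c}"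
      using ts(2) assms by (auto simp: min_def max_def)
  qed
  finally show "partition_sum p ts \<le> path_length p a b + path_length p b c" .
qed

lemma path_length_add:
  "a \<le> b \<Longrightarrow> b \<le> c \<Longrightarrow> path_length p a c = path_length p a b + path_length p b c"
  by (intro antisym path_length_add_le path_length_add_ge)

text \<open>A fixed partition, clamped to the shortened interval, gives a sum depending
  continuously on the end point; a supremum of such sums is lower semicontinuous.\<close>
lemma path_length_lsc:
  fixes p :: "real \<Rightarrow> 'a::metric_space"
  assumes p: "continuous_on {a..b} p" and t: "t \<in> {a..b}"
  shows "c < path_length p a t \<Longrightarrow> \<forall>\<^sub>F t' in at t within {a..b}. c < path_length p a t'"
    and "c < path_length p t b \<Longrightarrow> \<forall>\<^sub>F t' in at t within {a..b}. c < path_length p t' b"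
proof -
  have cont: "((\<lambda>t'. partition_sum p (map (f t') ts)) \<longlongrightarrow> partition_sum p (map (f t) ts))
      (at t within {a..b})"
    if f: "\<And>s. s \<in> set ts \<Longrightarrow> continuous_on {a..b} (\<lambda>t'. f t' s)"
       "\<And>s t'. s \<in> set ts \<Longrightarrow> t' \<in> {a..b} \<Longrightarrow> f t' s \<in> {a..b}" for ts and f :: "real \<Rightarrow> real \<Rightarrow> real"
  proof -
    have 1: "((\<lambda>t'. p (f t' s)) \<longlongrightarrow> p (f t s)) (at t within {a..b})" if "s \<in> set ts" for s
    proof -
      have "continuous_on {a..b} (\<lambda>t'. p (f t' s))"
        by (rule continuous_on_compose2[OF p f(1)[OF that]]) (use f(2)[OF that] in blast)
      then show ?thesis using t by (simp add: continuous_on_def)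
    qed
    show ?thesis
      unfolding partition_sum_def length_map
      by (intro tendsto_sum tendsto_ennrealI tendsto_dist) (auto intro!: 1)
  qed
  show "\<forall>\<^sub>F t' in at t within {a..b}. c < path_length p a t'" if c: "c < path_length p a t"
  proof -
    obtain ts where ts: "sorted ts" "set ts \<subseteq> {a..t}" "c < partition_sum p ts"
      using c unfolding path_length_SUP less_SUP_iff by auto
    have eq: "map (min t) ts = ts" using ts(2) by (intro map_idI) auto
    have "((\<lambda>t'. partition_sum p (map (min t') ts)) \<longlongrightarrow> partition_sum p (map (min t) ts))
        (at t within {a..b})"
      by (rule cont) (use ts(2) t in \<open>auto intro!: continuous_intros\<close>)
    then have "\<forall>\<^sub>F t' in at t within {a..b}. c < partition_sum p (map (min t') ts)"
      using ts(3) eq order_tendstoD(1) by metis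
    moreover have "\<forall>\<^sub>F t' in at t within {a..b}. t' \<in> {a..b}"
      by (simp add: eventually_at_filter)
    ultimately show ?thesis
    proof eventually_elim
      case (elim t')
      have "partition_sum p (map (min t') ts) \<le> path_length p a t'"
        using ts(1,2) elim(2)
        by (intro partition_sum_le_path_length sorted_map_mono)
          (auto intro!: mono_onI simp: min_def)
      with elim show ?case by auto
    qed
  qed
  show "\<forall>\<^sub>F t' in at t within {a..b}. c < path_length p t' b" if c: "c < path_length p t b"
  proof -
    obtain ts where ts: "sorted ts" "set ts \<subseteq> {t..b}" "c < partition_sum p ts"
      using c unfolding path_length_SUP less_SUP_iff by auto
    have eq: "map (max t) ts = ts" using ts(2) by (intro map_idI) auto
    have "((\<lambda>t'. partition_sum p (map (max t') ts)) \<longlongrightarrow> partition_sum p (map (max t) ts))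
        (at t within {a..b})"
      by (rule cont) (use ts(2) t in \<open>auto intro!: continuous_intros\<close>)
    then have "\<forall>\<^sub>F t' in at t within {a..b}. c < partition_sum p (map (max t') ts)"
      using ts(3) eq order_tendstoD(1) by metis
    moreover have "\<forall>\<^sub>F t' in at t within {a..b}. t' \<in> {a..b}"
      by (simp add: eventually_at_filter)
    ultimately show ?thesis
    proof eventually_elim
      case (elim t')
      have "partition_sum p (map (max t') ts) \<le> path_length p t' b"
        using ts(1,2) elim(2)
        by (intro partition_sum_le_path_length sorted_map_mono)
          (auto intro!: mono_onI simp: max_def)
      with elim show ?case by auto
    qed
  qed
qed

lemma path_length_finite_sub:
  assumes "path_length p a b < \<infinity>" "a \<le> s" "t \<le> b"
  shows "path_length p s t < \<infinity>"
  using path_length_mono[of a s t b p] assms by (auto intro: le_less_trans)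

lemma path_length_self [simp]: "path_length p a a = 0"
proof -
  have "partition_sum p ts = 0" if "set ts \<subseteq> {a..a}" for ts
  proof -
    have "ts ! i = a" if "i < length ts" for i
      using \<open>set ts \<subseteq> {a..a}\<close> nth_mem[OF that] by (metis atLeastAtMost_singleton singletonD subsetD)
    then show ?thesis by (auto simp: partition_sum_def)
  qed
  then have "path_length p a a \<le> 0" unfolding path_length_SUP by (intro SUP_least) auto
  then show ?thesis by simp
qed

text \<open>The lengths of the parts before and after \<open>t\<close> are lower semicontinuous in \<open>t\<close> and have a
  constant finite sum, so both are also upper semicontinuous.\<close>
lemma continuous_on_length_function:
  assumes p: "continuous_on {a..b} p" and fin: "path_length p a b < \<infinity>"
  shows "continuous_on {a..b} (\<lambda>t. enn2real (path_length p a t))"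
  unfolding continuous_on_def
proof (intro ballI order_tendstoI)
  fix t c assume t: "t \<in> {a..b}"
  let ?l = "\<lambda>t. enn2real (path_length p a t)" and ?r = "\<lambda>t. enn2real (path_length p t b)"
  have l: "path_length p a s = ennreal (?l s)" and r: "path_length p s b = ennreal (?r s)"
    if "s \<in> {a..b}" for s
    using path_length_finite_sub[OF fin] that by auto
  have add: "?l s + ?r s = ?l b" if "s \<in> {a..b}" for s
  proof -
    have "path_length p a b = ennreal (?l s + ?r s)"
      using path_length_add[of a s b p] that l[OF that] r[OF that] by (simp add: ennreal_plus)
    then show ?thesis by (metis enn2real_ennreal enn2real_nonneg add_nonneg_nonneg)
  qed
  have ev: "\<forall>\<^sub>F t' in at t within {a..b}. t' \<in> {a..b}"
    by (simp add: eventually_at_filter)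
  show "\<forall>\<^sub>F t' in at t within {a..b}. c < ?l t'" if "c < ?l t"
  proof (cases "c < 0")
    case True
    then show ?thesis by (auto intro!: always_eventually less_le_trans[OF _ enn2real_nonneg])
  next
    case False
    then have "ennreal c < path_length p a t"
      using that l[OF t] by (metis ennreal_less_iff not_le)
    from path_length_lsc(1)[OF p t this] ev show ?thesis
    proof eventually_elim
      case (elim t')
      then show ?case using l[of t'] False by (metis ennreal_less_iff not_le)
    qed
  qed
  show "\<forall>\<^sub>F t' in at t within {a..b}. ?l t' < c" if "?l t < c"
  proof (cases "c > ?l b")
    case True
    from ev show ?thesis
    proof eventually_elim
      case (elim t')
      then show ?case using add[of t'] True enn2real_nonneg[of "path_length p t' b"] by linarith
    qed
  next
    case False
    then have "ennreal (?l b - c) < path_length p t b"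
      using that r[OF t] add[OF t] by (metis add_diff_cancel_left' diff_ge_0_iff_ge diff_less_eq
        ennreal_less_iff less_diff_eq not_le add.commute)
    from path_length_lsc(2)[OF p t this] ev show ?thesis
    proof eventually_elim
      case (elim t')
      then have "?l b - c < ?r t'" using r[of t'] False by (metis diff_ge_0_iff_ge ennreal_less_iff not_le)
      then show ?case using add[of t'] elim by simp
    qed
  qed
qed

text \<open>This justifies the choice of the parameter made in \<^const>\<open>arc_param\<close>.\<close>
lemma length_function_attains:
  assumes p: "continuous_on {a..b} p" and fin: "path_length p a b < \<infinity>" and "a \<le> b"
    and s: "0 \<le> s" "s \<le> enn2real (path_length p a b)"
  shows "\<exists>t. t \<in> {a..b} \<and> path_length p a t = ennreal s"
proof -
  obtain t where "a \<le> t" "t \<le> b" "enn2real (path_length p a t) = s"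
    using IVT'[of "\<lambda>t. enn2real (path_length p a t)" a s b] assms continuous_on_length_function[OF p fin]
    by auto
  then show ?thesis
    using path_length_finite_sub[OF fin, of a t] by (intro exI[of _ t]) auto
qed

lemma arc_param_eq:
  assumes "rect_path p a b" and s: "0 \<le> s" "s \<le> enn2real (path_length p a b)"
  obtains t where "t \<in> {a..b}" "path_length p a t = ennreal s" "arc_param p a b s = p t"
  using someI_ex[OF length_function_attains[of a b p s]] assms
  unfolding arc_param_def rect_path_def by (smt (verit) someI_ex)

lemma dist_le_path_length_diff:
  assumes "path_length p a b < \<infinity>" "s \<in> {a..b}" "t \<in> {a..b}"
  shows "dist (p s) (p t) \<le> \<bar>enn2real (path_length p a s) - enn2real (path_length p a t)\<bar>"
proof -
  have *: "dist (p s) (p t) \<le> enn2real (path_length p a t) - enn2real (path_length p a s)"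
    if "s \<in> {a..b}" "t \<in> {a..b}" "s \<le> t" for s t
  proof -
    have fin: "path_length p a s < \<infinity>" "path_length p s t < \<infinity>"
      using path_length_finite_sub[OF assms(1)] that by auto
    have "path_length p a t = path_length p a s + path_length p s t"
      using path_length_add that by auto
    then have "enn2real (path_length p a t) = enn2real (path_length p a s) + enn2real (path_length p s t)"
      using fin by (simp add: enn2real_plus)
    moreover have "dist (p s) (p t) \<le> enn2real (path_length p s t)"
      using enn2real_mono[OF dist_le_path_length[of s t p]] that fin by simp
    ultimately show ?thesis by simp
  qed
  show ?thesis
    using *[of s t] *[of t s] assms by (cases "s \<le> t") (auto simp: dist_commute)
qed

lemma dist_arc_param_le:
  assumes p: "rect_path p a b" and s: "s \<in> {0..enn2real (path_length p a b)}"
    and t: "t \<in> {a..b}"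
  shows "dist (arc_param p a b s) (p t) \<le> \<bar>s - enn2real (path_length p a t)\<bar>"
proof -
  obtain t1 where "t1 \<in> {a..b}" "path_length p a t1 = ennreal s" "arc_param p a b s = p t1"
    using arc_param_eq[OF p, of s] s by auto
  moreover have "path_length p a b < \<infinity>" using p by (simp add: rect_path_def)
  ultimately show ?thesis using dist_le_path_length_diff[of p a b t1 t] s t by auto
qed

lemma continuous_on_arc_param:
  assumes p: "rect_path p a b"
  shows "continuous_on {0..enn2real (path_length p a b)} (arc_param p a b)"
proof -
  have "dist (arc_param p a b s) (arc_param p a b s') \<le> dist s s'"
    if s: "s \<in> {0..enn2real (path_length p a b)}" "s' \<in> {0..enn2real (path_length p a b)}" for s s'
  proof -
    obtain t where "t \<in> {a..b}" "path_length p a t = ennreal s'" "arc_param p a b s' = p t"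
      using arc_param_eq[OF p, of s'] s by auto
    then show ?thesis using dist_arc_param_le[OF p s(1), of t] s by (simp add: dist_real_def)
  qed
  then show ?thesis
    unfolding continuous_on_iff by (meson le_less_trans)
qed

lemma borel_measurable_line_integrand:
  fixes \<rho> :: "'a::metric_space \<Rightarrow> ennreal"
  assumes p: "rect_path p a b" and [measurable]: "\<rho> \<in> borel_measurable borel"
  shows "(\<lambda>s. \<rho> (arc_param p a b s) * indicator {0..enn2real (path_length p a b)} s)
           \<in> borel_measurable borel"
proof -
  have "arc_param p a b \<in> borel_measurable (restrict_space borel {0..enn2real (path_length p a b)})"
    by (rule borel_measurable_continuous_on_restrict[OF continuous_on_arc_param[OF p]])
  then have "(\<lambda>s. \<rho> (arc_param p a b s)) \<in> borel_measurable (restrict_space borel {0..enn2real (path_length p a b)})"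
    by measurable
  then show ?thesis
    by (subst (asm) borel_measurable_restrict_space_iff_ennreal) auto
qed

lemma line_integral_lborel:
  fixes \<rho> :: "'a::metric_space \<Rightarrow> ennreal"
  assumes p: "rect_path p a b" and \<rho>: "\<rho> \<in> borel_measurable borel"
  shows "line_integral \<rho> p a b =
    (\<integral>\<^sup>+ s. \<rho> (arc_param p a b s) * indicator {0..enn2real (path_length p a b)} s \<partial>lborel)"
  unfolding line_integral_def
  by (rule nn_integral_completion)

lemma line_integral_mono:
  assumes p: "rect_path p a b" and le: "\<And>t. t \<in> {a..b} \<Longrightarrow> \<rho> (p t) \<le> \<sigma> (p t)"
  shows "line_integral \<rho> p a b \<le> line_integral \<sigma> p a b"
  unfolding line_integral_def
proof (rule nn_integral_mono)
  fix s :: real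
  show "\<rho> (arc_param p a b s) * indicator {0..enn2real (path_length p a b)} s
      \<le> \<sigma> (arc_param p a b s) * indicator {0..enn2real (path_length p a b)} s"
  proof (cases "s \<in> {0..enn2real (path_length p a b)}")
    case True
    then obtain t where "t \<in> {a..b}" "arc_param p a b s = p t"
      using arc_param_eq[OF p, of s] by auto
    then show ?thesis using le[of t] by (simp add: mult_right_mono)
  qed simp
qed

lemma line_integral_cmult:
  assumes p: "rect_path p a b" and [measurable]: "\<rho> \<in> borel_measurable borel"
  shows "line_integral (\<lambda>x. c * \<rho> x) p a b = c * line_integral \<rho> p a b"
  unfolding line_integral_lborel[OF p assms(2)]
  using borel_measurable_line_integrand[OF p assms(2)]
  by (subst line_integral_lborel[OF p]) (auto simp: mult.assoc intro!: nn_integral_cmult)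

lemma line_integral_one:
  assumes "rect_path p a b"
  shows "line_integral (\<lambda>_. 1) p a b = path_length p a b"
  using assms by (simp add: line_integral_lborel rect_path_def)

lemma rect_path_subpath:
  assumes p: "rect_path p a b" and "a \<le> c" "c \<le> d" "d \<le> b" "p c \<noteq> p d"
  shows "rect_path p c d"
  using assms path_length_finite_sub[of p a b c d]
  unfolding rect_path_def constant_on_def
  by (auto intro: continuous_on_subset) (metis atLeastAtMost_iff order_refl)

text \<open>The arc length parametrization of a subpath is a translate of that of the whole path.\<close>
lemma line_integral_subpath_le:
  fixes \<rho> :: "'a::metric_space \<Rightarrow> ennreal"
  assumes p: "rect_path p a b" and cd: "a \<le> c" "c \<le> d" "d \<le> b" and p': "rect_path p c d"
    and [measurable]: "\<rho> \<in> borel_measurable borel"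
  shows "line_integral \<rho> p c d \<le> line_integral \<rho> p a b"
proof -
  define l where "l = enn2real (path_length p a c)"
  have fin: "path_length p a b < \<infinity>" using p by (simp add: rect_path_def)
  note fin' = path_length_finite_sub[OF fin]
  have l: "path_length p a c = ennreal l" unfolding l_def using fin'[of a c] cd by auto
  have add: "enn2real (path_length p a t) = l + enn2real (path_length p c t)" if "c \<le> t" "t \<le> b" for t
    using path_length_add[of a c t p] fin'[of a c] fin'[of c t] that cd
    by (simp add: enn2real_plus l_def)
  have "0 \<le> l" by (simp add: l_def)
  have len: "enn2real (path_length p a d) = l + enn2real (path_length p c d)" using add cd by auto
  have "enn2real (path_length p a d) \<le> enn2real (path_length p a b)"
    using path_length_mono[of a a d b p] fin cd by (intro enn2real_mono) auto
  then have L: "l + enn2real (path_length p c d) \<le> enn2real (path_length p a b)" using len by simp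
  \<comment> \<open>The parameters chosen for the two parametrizations may differ, but the path has length zero,
    hence does not move, between them.\<close>
  have arc: "arc_param p a b (l + s) = arc_param p c d s"
    if s: "s \<in> {0..enn2real (path_length p c d)}" for s
  proof -
    obtain t where t: "t \<in> {c..d}" "path_length p c t = ennreal s" "arc_param p c d s = p t"
      using arc_param_eq[OF p', of s] s by auto
    have "dist (arc_param p a b (l + s)) (p t) \<le> \<bar>l + s - enn2real (path_length p a t)\<bar>"
      using dist_arc_param_le[OF p, of "l + s" t] t cd s L \<open>0 \<le> l\<close> by auto
    also have "\<dots> = 0" using add[of t] t cd s by simp
    finally show ?thesis using t by simp
  qed
  have "line_integral \<rho> p c d =
      (\<integral>\<^sup>+ s. \<rho> (arc_param p a b (l + s)) * indicator {0..enn2real (path_length p c d)} s \<partial>lborel)"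
    unfolding line_integral_lborel[OF p' assms(6)]
    by (intro nn_integral_cong) (auto simp: arc split: split_indicator)
  also have "\<dots> \<le> (\<integral>\<^sup>+ s. \<rho> (arc_param p a b (l + 1 * s))
      * indicator {0..enn2real (path_length p a b)} (l + 1 * s) \<partial>lborel)"
    using L \<open>0 \<le> l\<close> by (intro nn_integral_mono) (auto split: split_indicator)
  also have "\<dots> = line_integral \<rho> p a b"
    unfolding line_integral_lborel[OF p assms(6)]
    by (subst nn_integral_real_affine[where c=1 and t=l,
          OF borel_measurable_line_integrand[OF p assms(6)]]) simp_all
  finally show ?thesis .
qed

section \<open>Upper gradients approximating weak upper gradients\<close>

lemma borel_regularD:
  assumes "borel_regular \<mu>"
  shows space_carath_borel: "space (carath \<mu>) = UNIV"
    and sets_borel_subset_carath: "sets borel \<subseteq> sets (carath \<mu>)"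
    and emeasure_carath_eq: "A \<in> sets (carath \<mu>) \<Longrightarrow> emeasure (carath \<mu>) A = \<mu> A"
  using assms unfolding borel_regular_def
  by (auto simp: space_carath sets_carath emeasure_carath)

lemma measurable_carath_borel:
  assumes "borel_regular \<mu>" "f \<in> borel_measurable borel"
  shows "f \<in> borel_measurable (carath \<mu>)"
proof (rule measurableI)
  fix A :: "'b set" assume "A \<in> sets borel"
  then have "f -` A \<inter> space borel \<in> sets borel" using assms(2) by (rule measurable_sets[rotated])
  then show "f -` A \<inter> space (carath \<mu>) \<in> sets (carath \<mu>)"
    using sets_borel_subset_carath[OF assms(1)] space_carath_borel[OF assms(1)] by auto
qed simp

text \<open>By Borel regularity and \<open>\<sigma>\<close>-finiteness every Caratheodory measurable set lies in the
  completion of the Borel measure, so \<open>g\<close> agrees with a Borel function outside a Borel null set,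
  on which the majorant is set to \<open>\<infinity>\<close>.\<close>
lemma borel_majorant:
  fixes \<mu> :: "'a::metric_space set \<Rightarrow> ennreal" and g :: "'a \<Rightarrow> ennreal"
  assumes \<mu>: "borel_regular \<mu>" and fin: "\<And>x r. 0 < r \<Longrightarrow> \<mu> (ball x r) < \<infinity>"
    and g: "g \<in> borel_measurable (carath \<mu>)"
  obtains g' where "g' \<in> borel_measurable borel" "\<And>x. g x \<le> g' x"
    "(\<integral>\<^sup>+ x. g' x \<partial>carath \<mu>) = (\<integral>\<^sup>+ x. g x \<partial>carath \<mu>)"
proof -
  define M where "M = carath \<mu>"
  have sp: "space M = UNIV" and sub: "\<And>A. A \<in> sets borel \<Longrightarrow> A \<in> sets M"
    and em: "\<And>A. A \<in> sets M \<Longrightarrow> emeasure M A = \<mu> A"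
    unfolding M_def
    using space_carath_borel[OF \<mu>] sets_borel_subset_carath[OF \<mu>] emeasure_carath_eq[OF \<mu>]
    by blast+
  have hull: "\<exists>B\<in>sets borel. A \<subseteq> B \<and> \<mu> B = \<mu> A" for A
    using \<mu> by (simp add: borel_regular_def)
  define N where "N = distr M borel (\<lambda>x. x)"
  have id: "(\<lambda>x. x) \<in> measurable M borel"
    by (rule measurableI) (simp_all add: sub sp)
  have sN: "sets N = sets borel" "space N = UNIV" by (auto simp: N_def)
  have eN: "emeasure N A = emeasure M A" if "A \<in> sets borel" for A
    unfolding N_def using emeasure_distr[OF id that] sp by simp
  have AM: "A \<in> sets (completion N)" if A: "A \<in> sets M" for A
  proof -
    fix x0 :: 'a
    have "A \<inter> ball x0 (real (Suc n)) \<in> sets (completion N)" for n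
    proof -
      let ?A = "A \<inter> ball x0 (real (Suc n))"
      have balls: "ball x0 (real (Suc n)) \<in> sets M" by (intro sub borel_open open_ball)
      have As: "?A \<in> sets M" using A balls by (rule sets.Int)
      obtain B where B: "B \<in> sets borel" "?A \<subseteq> B" "\<mu> B = \<mu> ?A" using hull[of ?A] by metis
      have Bs: "B \<in> sets M" using B(1) by (rule sub)
      have "\<mu> ?A \<le> \<mu> (ball x0 (real (Suc n)))"
        using emeasure_mono[OF Int_lower2 balls, of A] unfolding em[OF As] em[OF balls] .
      then have "\<mu> ?A < \<infinity>" by (rule le_less_trans) (rule fin, simp)
      then have "emeasure M ?A \<noteq> \<infinity>" unfolding em[OF As] by (rule less_imp_neq)
      then have "emeasure M (B - ?A) = emeasure M B - emeasure M ?A"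
        using B(2) As Bs by (intro emeasure_Diff)
      also have "\<dots> = 0"
        unfolding em[OF As] em[OF Bs] B(3) using \<open>\<mu> ?A < \<infinity>\<close> by (simp add: less_top)
      finally have "\<mu> (B - ?A) = 0" using em[OF sets.Diff[OF Bs As]] by simp
      then obtain Z where Z: "Z \<in> sets borel" "B - ?A \<subseteq> Z" "\<mu> Z = 0"
        using hull[of "B - ?A"] by metis
      then have "Z \<in> null_sets N" using eN em[OF sub[OF Z(1)]] sN by (auto simp: null_sets_def)
      then have "B - ?A \<in> sets (completion N)"
        using Z(2) by (intro sets_completionI_sub)
      moreover have "B \<in> sets (completion N)" using B sN by auto
      ultimately have "B - (B - ?A) \<in> sets (completion N)" by blast
      then show ?thesis using B(2) by (simp add: double_diff)
    qed
    then have "(\<Union>n. A \<inter> ball x0 (real (Suc n))) \<in> sets (completion N)" by blast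
    moreover have "(\<Union>n. A \<inter> ball x0 (real (Suc n))) = A"
    proof -
      have "\<exists>n. x \<in> ball x0 (real (Suc n))" for x
      proof -
        obtain n where "dist x0 x < real n" using reals_Archimedean2 by blast
        then have "x \<in> ball x0 (real (Suc n))" by simp
        then show ?thesis ..
      qed
      then show ?thesis by blast
    qed
    ultimately show ?thesis by simp
  qed
  have "g \<in> borel_measurable (completion N)"
  proof (rule measurableI)
    fix A :: "ennreal set" assume "A \<in> sets borel"
    then have "g -` A \<inter> space M \<in> sets M" using g M_def measurable_sets by blast
    then show "g -` A \<inter> space (completion N) \<in> sets (completion N)" using AM sp sN by simp
  qed simp
  from completion_ex_borel_measurable[OF this] obtain h
    where h: "h \<in> borel_measurable N" "AE x in N. g x = h x" by blast
  from AE_E[OF h(2)] obtain Z where Z: "{x. g x \<noteq> h x} \<subseteq> Z" "emeasure N Z = 0" "Z \<in> sets borel"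
    using sN by auto
  define g' where "g' x = (if x \<in> Z then \<infinity> else h x)" for x
  have hb [measurable]: "h \<in> borel_measurable borel" using h(1) sN by (simp cong: measurable_cong_sets)
  have "g' \<in> borel_measurable borel"
    unfolding g'_def using Z(3) by (intro measurable_If_set) auto
  moreover have "g x \<le> g' x" for x using Z(1) by (cases "g x = h x") (auto simp: g'_def)
  moreover have "(\<integral>\<^sup>+ x. g' x \<partial>M) = (\<integral>\<^sup>+ x. g x \<partial>M)"
  proof (rule nn_integral_cong_AE)
    have "Z \<in> null_sets M" using Z eN sub by (auto simp: null_sets_def)
    then show "AE x in M. g' x = g x"
      by (rule AE_I'[where N=Z]) (use Z(1) in \<open>auto simp: g'_def\<close>)
  qed
  ultimately show ?thesis using that M_def by blast
qed

lemma upper_gradient_on_path_mono: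
  assumes "upper_gradient_on_path u g p a b" "line_integral g p a b \<le> line_integral g' p a b"
  shows "upper_gradient_on_path u g' p a b"
  using assms unfolding upper_gradient_on_path_def
  by (metis (full_types) infinity_ennreal_def order_trans top_unique)

text \<open>Adding a small multiple of a function \<open>\<rho>\<close> that has infinite integral along all exceptional
  paths makes the upper gradient condition hold on these paths as well.\<close>
lemma weak_upper_gradient_approx:
  fixes \<mu> :: "'a::metric_space set \<Rightarrow> ennreal"
  assumes \<mu>: "borel_regular \<mu>" and fin: "\<And>x r. 0 < r \<Longrightarrow> \<mu> (ball x r) < \<infinity>"
    and g: "weak_upper_gradient \<mu> u g" and e: "0 < e"
  obtains g' where "upper_gradient u g'"
    "(\<integral>\<^sup>+ x. g' x \<partial>carath \<mu>) \<le> (\<integral>\<^sup>+ x. g x \<partial>carath \<mu>) + ennreal e"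
proof -
  obtain h where h: "h \<in> borel_measurable borel" "\<And>x. g x \<le> h x"
    "(\<integral>\<^sup>+ x. h x \<partial>carath \<mu>) = (\<integral>\<^sup>+ x. g x \<partial>carath \<mu>)"
    using borel_majorant[OF \<mu> fin, of g] g unfolding weak_upper_gradient_def by blast
  obtain \<rho> where \<rho>: "\<rho> \<in> borel_measurable borel" "(\<integral>\<^sup>+ x. \<rho> x \<partial>carath \<mu>) < \<infinity>"
    and bad: "\<And>p a b. rect_path p a b \<Longrightarrow> \<not> upper_gradient_on_path u g p a b \<Longrightarrow>
      line_integral \<rho> p a b = \<infinity>"
    using g unfolding weak_upper_gradient_def zero_modulus_def by auto
  define I where "I = enn2real (\<integral>\<^sup>+ x. \<rho> x \<partial>carath \<mu>)"
  have I: "(\<integral>\<^sup>+ x. \<rho> x \<partial>carath \<mu>) = ennreal I" "0 \<le> I" unfolding I_def using \<rho>(2) by auto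
  define c where "c = e / (I + 1)"
  have c: "0 < c" "c * I \<le> e"
    using e I(2) by (auto simp: c_def field_simps)
  define g' where "g' x = h x + ennreal c * \<rho> x" for x
  note [measurable] = h(1) \<rho>(1)
  have g'b: "g' \<in> borel_measurable borel" unfolding g'_def by measurable
  have "upper_gradient_on_path u g' p a b" if p: "rect_path p a b" for p a b
  proof (cases "upper_gradient_on_path u g p a b")
    case True
    then show ?thesis
      by (rule upper_gradient_on_path_mono, intro line_integral_mono[OF p])
        (simp add: g'_def add_increasing2 h(2))
  next
    case False
    have "line_integral (\<lambda>x. ennreal c * \<rho> x) p a b = \<infinity>"
      using bad[OF p False] c by (simp add: line_integral_cmult[OF p \<rho>(1)] ennreal_mult_top)
    moreover have "line_integral (\<lambda>x. ennreal c * \<rho> x) p a b \<le> line_integral g' p a b"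
      by (intro line_integral_mono[OF p]) (simp add: g'_def)
    ultimately have "line_integral g' p a b = \<infinity>" by (simp add: top_unique)
    then show ?thesis by (simp add: upper_gradient_on_path_def)
  qed
  then have "upper_gradient u g'" using g'b by (simp add: upper_gradient_def)
  moreover have "(\<integral>\<^sup>+ x. g' x \<partial>carath \<mu>) \<le> (\<integral>\<^sup>+ x. g x \<partial>carath \<mu>) + ennreal e"
  proof -
    have "(\<integral>\<^sup>+ x. g' x \<partial>carath \<mu>) = (\<integral>\<^sup>+ x. h x \<partial>carath \<mu>) + ennreal c * (\<integral>\<^sup>+ x. \<rho> x \<partial>carath \<mu>)"
      unfolding g'_def
      by (subst nn_integral_add)
        (simp_all add: nn_integral_cmult measurable_carath_borel[OF \<mu>] h(1) \<rho>(1))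
    also have "\<dots> = (\<integral>\<^sup>+ x. g x \<partial>carath \<mu>) + ennreal (c * I)"
      using c I by (simp add: h(3) ennreal_mult)
    also have "\<dots> \<le> (\<integral>\<^sup>+ x. g x \<partial>carath \<mu>) + ennreal e"
      using c by (intro add_left_mono ennreal_leI) auto
    finally show ?thesis .
  qed
  ultimately show ?thesis by (rule that)
qed

section \<open>Truncation of functions and their upper gradients\<close>

lemma upper_gradient_real_iff:
  "upper_gradient (\<lambda>x. ereal (u x)) g \<longleftrightarrow> g \<in> borel_measurable borel \<and>
     (\<forall>p a b. rect_path p a b \<longrightarrow> ennreal \<bar>u (p a) - u (p b)\<bar> \<le> line_integral g p a b)"
  by (simp add: upper_gradient_def upper_gradient_on_path_def)

lemma upper_gradient_imp_weak:
  assumes "borel_regular \<mu>" "upper_gradient u g"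
  shows "weak_upper_gradient \<mu> u g"
proof -
  have none: "{(p, a, b). rect_path p a b \<and> \<not> upper_gradient_on_path u g p a b} = {}"
    using assms(2) by (auto simp: upper_gradient_def)
  show ?thesis
    unfolding weak_upper_gradient_def none zero_modulus_def
    using assms by (auto simp: upper_gradient_def measurable_carath_borel
        intro!: bexI[of _ "\<lambda>_. 0"])
qed

lemma upper_gradient_dist: "upper_gradient (\<lambda>y. ereal (dist x y)) (\<lambda>_. 1)"
  unfolding upper_gradient_real_iff
proof (intro conjI allI impI)
  fix p :: "real \<Rightarrow> 'a" and a b assume p: "rect_path p a b"
  have "\<bar>dist x (p a) - dist x (p b)\<bar> \<le> dist (p a) (p b)"
    using dist_triangle[of x "p a" "p b"] dist_triangle[of x "p b" "p a"]
    by (simp add: dist_commute abs_le_iff)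
  then have "ennreal \<bar>dist x (p a) - dist x (p b)\<bar> \<le> ennreal (dist (p a) (p b))"
    by (rule ennreal_leI)
  also have "\<dots> \<le> path_length p a b"
    using p by (intro dist_le_path_length) (simp add: rect_path_def)
  finally show "ennreal \<bar>dist x (p a) - dist x (p b)\<bar> \<le> line_integral (\<lambda>_. 1) p a b"
    by (simp add: line_integral_one[OF p])
qed simp

lemma upper_gradient_affine:
  assumes "upper_gradient (\<lambda>x. ereal (u x)) g"
  shows "upper_gradient (\<lambda>x. ereal (k * u x + m)) (\<lambda>x. ennreal \<bar>k\<bar> * g x)"
  unfolding upper_gradient_real_iff
proof (intro conjI allI impI)
  have [measurable]: "g \<in> borel_measurable borel" using assms by (simp add: upper_gradient_def)
  then show "(\<lambda>x. ennreal \<bar>k\<bar> * g x) \<in> borel_measurable borel" by measurable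
  fix p :: "real \<Rightarrow> 'a" and a b assume p: "rect_path p a b"
  have "ennreal \<bar>k * u (p a) + m - (k * u (p b) + m)\<bar> = ennreal \<bar>k\<bar> * ennreal \<bar>u (p a) - u (p b)\<bar>"
    by (simp add: ennreal_mult[symmetric] abs_mult[symmetric] right_diff_distrib)
  also have "\<dots> \<le> ennreal \<bar>k\<bar> * line_integral g p a b"
    using assms p by (intro mult_left_mono) (auto simp: upper_gradient_real_iff)
  finally show "ennreal \<bar>k * u (p a) + m - (k * u (p b) + m)\<bar> \<le>
      line_integral (\<lambda>x. ennreal \<bar>k\<bar> * g x) p a b"
    by (simp add: line_integral_cmult[OF p])
qed

lemma upper_gradient_abs:
  assumes "upper_gradient (\<lambda>x. ereal (u x)) g"
  shows "upper_gradient (\<lambda>x. ereal \<bar>u x\<bar>) g"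
  using assms unfolding upper_gradient_real_iff
  by (meson abs_triangle_ineq3 ennreal_leI order_trans)

text \<open>Take the first time \<open>d\<close> at which \<open>f\<close> has the value \<open>B\<close>, and the last time before \<open>d\<close> at which
  it has the value \<open>A\<close>.\<close>
lemma crossing_subinterval:
  fixes f :: "real \<Rightarrow> real"
  assumes f: "continuous_on {a..b} f" and "a \<le> b" "A < B" "f a \<le> A" "B \<le> f b"
  obtains c d where "a \<le> c" "c \<le> d" "d \<le> b" "f c = A" "f d = B"
    "\<And>t. c \<le> t \<Longrightarrow> t \<le> d \<Longrightarrow> A \<le> f t \<and> f t \<le> B"
proof -
  let ?D = "{a..b} \<inter> f -` {B}"
  have "compact ?D"
    using continuous_closed_preimage[OF f closed_atLeastAtMost closed_singleton, of B]
      compact_Int_closed[OF compact_Icc, of ?D a b] by (simp add: Int_assoc[symmetric])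
  moreover have "?D \<noteq> {}" using IVT'[of f a B b] assms by force
  ultimately obtain d where d: "d \<in> ?D" "\<And>t. t \<in> ?D \<Longrightarrow> d \<le> t"
    using compact_attains_inf[of ?D] by metis
  let ?C = "{a..d} \<inter> f -` {A}"
  have fd: "continuous_on {a..d} f" using f d by (auto intro: continuous_on_subset)
  have "compact ?C"
    using continuous_closed_preimage[OF fd closed_atLeastAtMost closed_singleton, of A]
      compact_Int_closed[OF compact_Icc, of ?C a d] by (simp add: Int_assoc[symmetric])
  moreover have "?C \<noteq> {}" using IVT'[of f a A d] fd d assms by force
  ultimately obtain c where c: "c \<in> ?C" "\<And>t. t \<in> ?C \<Longrightarrow> t \<le> c"
    using compact_attains_sup[of ?C] by metis
  have "A \<le> f t" if t: "c \<le> t" "t \<le> d" for t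
  proof (rule ccontr)
    assume "\<not> A \<le> f t"
    moreover have "continuous_on {t..d} f" using fd c t by (auto intro: continuous_on_subset)
    ultimately obtain s where "t \<le> s" "s \<le> d" "f s = A"
      using IVT'[of f t A d] d assms t by auto
    moreover from this have "s = t" using c(2)[of s] c(1) t by auto
    ultimately show False using \<open>\<not> A \<le> f t\<close> by simp
  qed
  moreover have "f t \<le> B" if t: "c \<le> t" "t \<le> d" for t
  proof (rule ccontr)
    assume *: "\<not> f t \<le> B"
    moreover have "continuous_on {a..t} f" using fd c t by (auto intro: continuous_on_subset)
    ultimately obtain s where "a \<le> s" "s \<le> t" "f s = B"
      using IVT'[of f a B t] c assms t by auto
    moreover from this have "s = t" using d(2)[of s] c(1) d(1) t by auto
    ultimately show False using * by simp
  qed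
  ultimately show ?thesis using c(1) d(1) by (intro that[of c d]) auto
qed

text \<open>If the truncated function has different values at the end points of a path, then some
  subpath stays in \<open>{\<alpha> \<le> u \<le> \<beta>}\<close> and \<open>u\<close> takes exactly these two values at its ends.\<close>
lemma upper_gradient_truncation:
  fixes u :: "'a::metric_space \<Rightarrow> real"
  assumes ug: "upper_gradient (\<lambda>x. ereal (u x)) g" and u: "continuous_on UNIV u" and "\<alpha> \<le> \<beta>"
  shows "upper_gradient (\<lambda>x. ereal (max \<alpha> (min \<beta> (u x)))) (\<lambda>x. g x * indicator {x. \<alpha> \<le> u x \<and> u x \<le> \<beta>} x)"
  unfolding upper_gradient_real_iff
proof (intro conjI allI impI)
  let ?S = "{x. \<alpha> \<le> u x \<and> u x \<le> \<beta>}" and ?v = "\<lambda>x. max \<alpha> (min \<beta> (u x))"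
  have g [measurable]: "g \<in> borel_measurable borel" using ug by (simp add: upper_gradient_def)
  have [measurable]: "u \<in> borel_measurable borel" using u by (rule borel_measurable_continuous_onI)
  show meas: "(\<lambda>x. g x * indicator ?S x) \<in> borel_measurable borel" by measurable
  fix p :: "real \<Rightarrow> 'a" and a b assume p: "rect_path p a b"
  have ab: "a \<le> b" and pc: "continuous_on {a..b} p" using p by (auto simp: rect_path_def)
  have up: "continuous_on {a..b} (\<lambda>t. u (p t))"
    using continuous_on_compose2[OF u pc] by auto
  have main: "ennreal \<bar>u (p c) - u (p d)\<bar> \<le> line_integral (\<lambda>x. g x * indicator ?S x) p a b"
    if cd: "a \<le> c" "c \<le> d" "d \<le> b" "u (p c) \<noteq> u (p d)" "\<And>t. c \<le> t \<Longrightarrow> t \<le> d \<Longrightarrow> p t \<in> ?S" for c d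
  proof -
    have p': "rect_path p c d" using rect_path_subpath[OF p cd(1-3)] cd(4) by metis
    have "ennreal \<bar>u (p c) - u (p d)\<bar> \<le> line_integral g p c d"
      using ug p' by (simp add: upper_gradient_real_iff)
    also have "\<dots> \<le> line_integral (\<lambda>x. g x * indicator ?S x) p c d"
      using cd(5) by (intro line_integral_mono[OF p']) auto
    also have "\<dots> \<le> line_integral (\<lambda>x. g x * indicator ?S x) p a b"
      by (rule line_integral_subpath_le[OF p cd(1-3) p' meas])
    finally show ?thesis .
  qed
  have v: "\<alpha> \<le> ?v x" "?v x \<le> \<beta>" for x using \<open>\<alpha> \<le> \<beta>\<close> by auto
  have lo: "u x \<le> ?v x" if "?v x < \<beta>" for x using that by linarith
  have hi: "?v x \<le> u x" if "\<alpha> < ?v x" for x using that by linarith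
  consider "?v (p a) = ?v (p b)" | "?v (p a) < ?v (p b)" | "?v (p b) < ?v (p a)" by linarith
  then show "ennreal \<bar>?v (p a) - ?v (p b)\<bar> \<le> line_integral (\<lambda>x. g x * indicator ?S x) p a b"
  proof cases
    case 2
    then have ends: "u (p a) \<le> ?v (p a)" "?v (p b) \<le> u (p b)"
      using v[of "p a"] v[of "p b"] by (intro lo hi; linarith)+
    obtain c d where cd: "a \<le> c" "c \<le> d" "d \<le> b" and e: "u (p c) = ?v (p a)" "u (p d) = ?v (p b)"
      and between: "\<And>t. c \<le> t \<Longrightarrow> t \<le> d \<Longrightarrow> ?v (p a) \<le> u (p t) \<and> u (p t) \<le> ?v (p b)"
      by (rule crossing_subinterval[OF up ab 2 ends]) (rule that; assumption)
    have "p t \<in> ?S" if "c \<le> t" "t \<le> d" for t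
    proof -
      have "\<alpha> \<le> u (p t)" "u (p t) \<le> \<beta>"
        using between[OF that] v[of "p a"] v[of "p b"] by linarith+
      then show ?thesis by simp
    qed
    moreover have "u (p c) \<noteq> u (p d)" using e 2 by linarith
    moreover have "u (p c) = ?v (p a)" "u (p d) = ?v (p b)" using e by linarith+
    ultimately show ?thesis using main[OF cd] by metis
  next
    case 3
    then have ends: "- u (p a) \<le> - ?v (p a)" "- ?v (p b) \<le> - u (p b)" "- ?v (p a) < - ?v (p b)"
      using v[of "p a"] v[of "p b"] hi[of "p a"] lo[of "p b"] by linarith+
    obtain c d where cd: "a \<le> c" "c \<le> d" "d \<le> b"
      and e: "- u (p c) = - ?v (p a)" "- u (p d) = - ?v (p b)"
      and between: "\<And>t. c \<le> t \<Longrightarrow> t \<le> d \<Longrightarrow> - ?v (p a) \<le> - u (p t) \<and> - u (p t) \<le> - ?v (p b)"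
      by (rule crossing_subinterval[OF continuous_on_minus[OF up] ab ends(3,1,2)]) (rule that; assumption)
    have "p t \<in> ?S" if "c \<le> t" "t \<le> d" for t
    proof -
      have "\<alpha> \<le> u (p t)" "u (p t) \<le> \<beta>"
        using between[OF that] v[of "p a"] v[of "p b"] by linarith+
      then show ?thesis by simp
    qed
    moreover have "u (p c) \<noteq> u (p d)" using e 3 by linarith
    moreover have "u (p c) = ?v (p a)" "u (p d) = ?v (p b)" using e by linarith+
    ultimately show ?thesis using main[OF cd] by metis
  qed simp
qed

section \<open>Capacity of balls\<close>

lemma cap1_le:
  fixes \<mu> :: "'a::metric_space set \<Rightarrow> ennreal"
  assumes \<mu>: "borel_regular \<mu>" and u: "continuous_on UNIV u" "\<And>x. x \<in> E \<Longrightarrow> u x = 1"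
    and int: "(\<integral>\<^sup>+ x. ennreal \<bar>u x\<bar> \<partial>carath \<mu>) < \<infinity>"
    and ug: "upper_gradient (\<lambda>x. ereal (u x)) g" and g: "(\<integral>\<^sup>+ x. g x \<partial>carath \<mu>) < \<infinity>"
  shows "cap1 \<mu> E \<le> (\<integral>\<^sup>+ x. g x \<partial>carath \<mu>)"
proof -
  have wug: "weak_upper_gradient \<mu> (\<lambda>x. ereal (u x)) g"
    by (rule upper_gradient_imp_weak[OF \<mu> ug])
  have "u \<in> borel_measurable borel" using u(1) by (rule borel_measurable_continuous_onI)
  then have "(\<lambda>x. ereal (u x)) \<in> borel_measurable (carath \<mu>)"
    by (intro borel_measurable_ereal measurable_carath_borel[OF \<mu>])
  moreover have "N11_norm \<mu> (\<lambda>x. ereal (u x)) < \<infinity>"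
  proof -
    have "(INF g\<in>{g. weak_upper_gradient \<mu> (\<lambda>x. ereal (u x)) g}. \<integral>\<^sup>+ x. g x \<partial>carath \<mu>)
        \<le> (\<integral>\<^sup>+ x. g x \<partial>carath \<mu>)"
      using wug by (intro INF_lower) auto
    then show ?thesis using g int by (auto simp: N11_norm_def intro: le_less_trans)
  qed
  ultimately have "(\<lambda>x. ereal (u x)) \<in> N11 \<mu>"
    using int by (simp add: N11_def L1_def)
  then show ?thesis unfolding cap1_def
    using u wug by (intro INF_lower2[of "(u, g)"]) auto
qed

text \<open>The test function is \<open>1\<close> on the ball, \<open>0\<close> outside the ball with twice the radius, and
  interpolates linearly in the distance; as a truncated distance function it has an upper
  gradient supported in the closed annulus, which lies in the open ball of radius \<open>3 R\<close>.\<close>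
lemma cap1_ball_le:
  fixes \<mu> :: "'a::metric_space set \<Rightarrow> ennreal"
  assumes \<mu>: "borel_regular \<mu>" and fin: "\<And>x r. 0 < r \<Longrightarrow> \<mu> (ball x r) < \<infinity>" and R: "0 < R"
  shows "cap1 \<mu> (ball x R) \<le> ennreal (1 / R) * \<mu> (ball x (3 * R))"
proof -
  define u where "u y = - (1 / R) * max R (min (2 * R) (dist x y)) + 2" for y
  define g where "g y = ennreal \<bar>- (1 / R)\<bar> * (1 * indicator {y. R \<le> dist x y \<and> dist x y \<le> 2 * R} y)"
    for y
  have "upper_gradient (\<lambda>y. ereal (u y)) g"
    unfolding u_def g_def
    by (rule upper_gradient_affine[OF upper_gradient_truncation[OF upper_gradient_dist]])
      (use R in \<open>auto intro!: continuous_intros\<close>)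
  have ball: "ball x (3 * R) \<in> sets (carath \<mu>)"
    using sets_borel_subset_carath[OF \<mu>] by auto
  have i: "(\<integral>\<^sup>+ y. c * indicator (ball x (3 * R)) y \<partial>carath \<mu>) = c * \<mu> (ball x (3 * R))" for c
    using nn_integral_cmult_indicator[OF ball] emeasure_carath_eq[OF \<mu> ball] by simp
  have "(\<integral>\<^sup>+ y. g y \<partial>carath \<mu>) \<le> (\<integral>\<^sup>+ y. ennreal (1 / R) * indicator (ball x (3 * R)) y \<partial>carath \<mu>)"
    using R by (intro nn_integral_mono) (auto simp: g_def split: split_indicator)
  then have g: "(\<integral>\<^sup>+ y. g y \<partial>carath \<mu>) \<le> ennreal (1 / R) * \<mu> (ball x (3 * R))"
    by (simp only: i)
  have fin': "ennreal (1 / R) * \<mu> (ball x (3 * R)) < \<infinity>" "1 * \<mu> (ball x (3 * R)) < \<infinity>"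
    using fin[of "3 * R" x] R by (auto simp: ennreal_mult_less_top)
  have "ennreal \<bar>u y\<bar> \<le> 1 * indicator (ball x (3 * R)) y" for y
  proof (cases "dist x y < 2 * R")
    case True
    then have "R \<le> max R (min (2 * R) (dist x y))" "max R (min (2 * R) (dist x y)) \<le> 2 * R"
      using R by auto
    then have "\<bar>u y\<bar> \<le> 1" using R by (auto simp: u_def field_simps abs_le_iff)
    then show ?thesis using True R by auto
  next
    case False
    then show ?thesis using R by (simp add: u_def)
  qed
  then have "(\<integral>\<^sup>+ y. ennreal \<bar>u y\<bar> \<partial>carath \<mu>) \<le> (\<integral>\<^sup>+ y. 1 * indicator (ball x (3 * R)) y \<partial>carath \<mu>)"
    by (intro nn_integral_mono) auto
  also have "\<dots> < \<infinity>" using fin'(2) by (simp only: i)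
  finally have "cap1 \<mu> (ball x R) \<le> (\<integral>\<^sup>+ y. g y \<partial>carath \<mu>)"
    using \<open>upper_gradient (\<lambda>y. ereal (u y)) g\<close> R le_less_trans[OF g fin'(1)]
    by (intro cap1_le[OF \<mu>, of u]) (auto simp: u_def intro!: continuous_intros)
  with g show ?thesis by (rule order_trans[rotated])
qed

section \<open>Covering and summation lemmas\<close>

text \<open>Greedy selection: keep a largest ball, discard all balls meeting it, and recurse.\<close>
lemma finite_Vitali:
  fixes \<rho> :: "'a::metric_space \<Rightarrow> real"
  assumes "finite C"
  shows "\<exists>F\<subseteq>C. disjoint_family_on (\<lambda>x. ball x (\<rho> x)) F \<and>
    (\<forall>x\<in>C. \<exists>y\<in>F. ball x (\<rho> x) \<subseteq> ball y (3 * \<rho> y))"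
  using assms
proof (induction C rule: finite_psubset_induct)
  case (psubset C)
  show ?case
  proof (cases "C = {}")
    case False
    then have "Max (\<rho> ` C) \<in> \<rho> ` C" using psubset.hyps by (intro Max_in) auto
    then obtain x where x: "x \<in> C" "Max (\<rho> ` C) = \<rho> x" by blast
    then have x: "x \<in> C" "\<And>y. y \<in> C \<Longrightarrow> \<rho> y \<le> \<rho> x"
      using Max_ge[of "\<rho> ` C"] psubset.hyps by auto
    show ?thesis
    proof (cases "ball x (\<rho> x) = {}")
      case True
      then have "\<rho> x \<le> 0" by simp
      then have "ball y (\<rho> y) = {}" if "y \<in> C" for y using x(2)[OF that] by (simp add: ball_eq_empty)
      then show ?thesis
        by (intro exI[of _ C]) (auto simp: disjoint_family_on_def simp del: ball_eq_empty)
    next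
      case ne: False
      define C' where "C' = {y \<in> C. ball y (\<rho> y) \<inter> ball x (\<rho> x) = {}}"
      have "x \<notin> C'" using ne unfolding C'_def by blast
      then have "C' \<subset> C" using x(1) unfolding C'_def by blast
      from psubset.IH[OF this] obtain F where F: "F \<subseteq> C'"
        "disjoint_family_on (\<lambda>x. ball x (\<rho> x)) F"
        "\<And>y. y \<in> C' \<Longrightarrow> \<exists>z\<in>F. ball y (\<rho> y) \<subseteq> ball z (3 * \<rho> z)"
        by metis
      have absorb: "ball y (\<rho> y) \<subseteq> ball x (3 * \<rho> x)" if y: "y \<in> C" "y \<notin> C'" for y
      proof
        fix w assume w: "w \<in> ball y (\<rho> y)"
        obtain z where z: "z \<in> ball y (\<rho> y)" "z \<in> ball x (\<rho> x)" using y by (auto simp: C'_def)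
        have "dist x w \<le> dist x z + dist z y + dist y w"
          using dist_triangle[of x w z] dist_triangle[of z w y] by linarith
        also have "\<dots> < 3 * \<rho> x" using w z x(2)[OF y(1)] by (simp add: dist_commute)
        finally show "w \<in> ball x (3 * \<rho> x)" by simp
      qed
      have "disjoint_family_on (\<lambda>x. ball x (\<rho> x)) (insert x F)"
        using F(1,2) unfolding disjoint_family_on_def C'_def by blast
      moreover have "insert x F \<subseteq> C" using F(1) x(1) by (auto simp: C'_def)
      moreover have "\<forall>y\<in>C. \<exists>z\<in>insert x F. ball y (\<rho> y) \<subseteq> ball z (3 * \<rho> z)"
        using absorb F(3) by blast
      ultimately show ?thesis by blast
    qed
  qed (simp add: disjoint_family_on_def)
qed

lemma compact_Vitali:
  fixes K :: "'a::metric_space set"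
  assumes "compact K" "\<And>x. x \<in> K \<Longrightarrow> 0 < \<rho> x"
  obtains F where "finite F" "F \<subseteq> K" "disjoint_family_on (\<lambda>x. ball x (\<rho> x)) F"
    "K \<subseteq> (\<Union>x\<in>F. ball x (3 * \<rho> x))"
proof -
  have "K \<subseteq> (\<Union>x\<in>K. ball x (\<rho> x))" using assms(2) by force
  then obtain C where C: "C \<subseteq> K" "finite C" "K \<subseteq> (\<Union>x\<in>C. ball x (\<rho> x))"
    using compactE_image[OF assms(1), of K "\<lambda>x. ball x (\<rho> x)"] by blast
  from finite_Vitali[OF C(2), of \<rho>] obtain F where F: "F \<subseteq> C"
    "disjoint_family_on (\<lambda>x. ball x (\<rho> x)) F"
    "\<And>x. x \<in> C \<Longrightarrow> \<exists>y\<in>F. ball x (\<rho> x) \<subseteq> ball y (3 * \<rho> y)" by metis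
  have "K \<subseteq> (\<Union>x\<in>F. ball x (3 * \<rho> x))"
  proof
    fix z assume "z \<in> K"
    then obtain x where "x \<in> C" "z \<in> ball x (\<rho> x)" using C(3) by blast
    then show "z \<in> (\<Union>x\<in>F. ball x (3 * \<rho> x))" using F(3)[of x] by blast
  qed
  then show ?thesis using that[of F] F(1,2) C(1,2) finite_subset by (metis subset_trans)
qed

lemma sum_powr_le_powr_sum:
  fixes a :: "'b \<Rightarrow> real"
  assumes "finite F" and a: "\<And>i. i \<in> F \<Longrightarrow> 0 \<le> a i" and q: "1 \<le> q"
  shows "(\<Sum>i\<in>F. a i powr q) \<le> (\<Sum>i\<in>F. a i) powr q"
proof -
  define S where "S = (\<Sum>i\<in>F. a i)"
  have powr: "x powr q = x * x powr (q - 1)" if "0 \<le> x" for x :: real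
    using that powr_add[of x 1 "q - 1"] by (cases "x = 0") auto
  have "(\<Sum>i\<in>F. a i powr q) \<le> (\<Sum>i\<in>F. a i * S powr (q - 1))"
  proof (rule sum_mono)
    fix i assume i: "i \<in> F"
    then have "a i \<le> S" unfolding S_def using a assms(1) by (intro member_le_sum) auto
    then show "a i powr q \<le> a i * S powr (q - 1)"
      unfolding powr[OF a[OF i]] using a[OF i] q by (intro mult_left_mono powr_mono2) auto
  qed
  also have "\<dots> = S powr q"
    unfolding sum_distrib_right[symmetric] S_def[symmetric] using a
    by (intro powr[symmetric]) (simp add: S_def sum_nonneg)
  finally show ?thesis by (simp add: S_def)
qed

text \<open>Fewer than half of the indices have \<open>x j > m\<close>. On the remaining ones, more than half of
  all, the average of \<open>y\<close> is at most \<open>2 Y / N\<close>.\<close>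
lemma ex_small_pair:
  fixes x y :: "nat \<Rightarrow> real"
  assumes x: "\<And>j. 0 \<le> x j" "(\<Sum>j<N. x j) \<le> X" and y: "\<And>j. 0 \<le> y j" "(\<Sum>j<N. y j) \<le> Y"
    and m: "0 < m" "2 * X < real N * m"
  obtains j where "j < N" "x j \<le> m" "real N * y j \<le> 2 * Y"
proof -
  define A where "A = {j. j < N \<and> m < x j}"
  define B where "B = {j. j < N \<and> x j \<le> m}"
  have fin: "finite A" "finite B" by (auto simp: A_def B_def)
  have "A \<union> B = {..<N}" "A \<inter> B = {}" by (auto simp: A_def B_def)
  then have card: "real N = real (card A) + real (card B)"
    using card_Un_disjoint[OF fin] by (metis card_lessThan of_nat_add)
  have "real (card A) * m \<le> (\<Sum>j\<in>A. x j)"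
    using sum_bounded_below[of A m x] by (auto simp: A_def)
  also have "\<dots> \<le> (\<Sum>j<N. x j)" using x by (intro sum_mono2) (auto simp: A_def)
  finally have cA: "real (card A) * m \<le> X" using x by simp
  have "\<exists>j\<in>B. real N * y j \<le> 2 * Y"
  proof (rule ccontr)
    assume "\<not> ?thesis"
    then have big: "2 * Y < real N * y j" if "j \<in> B" for j using that by auto
    have "2 * real (card A) * m < (real (card A) + real (card B)) * m" using cA m(2) unfolding card by linarith
    then have AB: "2 * real (card A) < real (card A) + real (card B)"
      using m(1) by (simp only: mult_less_cancel_right_pos)
    then have ne: "B \<noteq> {}" by auto
    have "2 * Y * real (card B) = (\<Sum>j\<in>B. 2 * Y)" by simp
    also have "\<dots> < (\<Sum>j\<in>B. real N * y j)" by (intro sum_strict_mono fin ne big)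
    also have "\<dots> = real N * (\<Sum>j\<in>B. y j)" by (simp add: sum_distrib_left)
    also have "\<dots> \<le> real N * Y"
    proof (intro mult_left_mono)
      have "(\<Sum>j\<in>B. y j) \<le> (\<Sum>j<N. y j)" using y by (intro sum_mono2) (auto simp: B_def)
      then show "(\<Sum>j\<in>B. y j) \<le> Y" using y by simp
    qed simp
    finally have "Y * (2 * real (card B)) < Y * real N" by (simp add: mult_ac)
    moreover have "0 \<le> Y" using sum_nonneg[of "{..<N}" y] y by auto
    moreover have "real N \<le> 2 * real (card B)" using AB card by simp
    ultimately show False using mult_left_mono[of "real N" "2 * real (card B)" Y] by linarith
  qed
  then show ?thesis using that by (auto simp: B_def)
qed

lemma ennpowr_inverse_le:
  assumes "x \<le> ennreal (t powr q)" "0 \<le> t" "0 < q"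
  shows "ennpowr x (1 / q) \<le> ennreal t"
proof -
  have fin: "x < \<infinity>" using assms(1) by (rule le_less_trans) simp
  then have "enn2real x \<le> t powr q" using enn2real_mono[OF assms(1)] by simp
  then have "enn2real x powr (1 / q) \<le> (t powr q) powr (1 / q)"
    using assms(3) by (intro powr_mono2) auto
  also have "\<dots> = t" using assms(2,3) by (simp add: powr_powr)
  finally show ?thesis using fin by (auto simp: ennpowr_def intro: ennreal_leI)
qed

lemma ennpowr_inverse_leD:
  assumes "ennpowr x (1 / q) \<le> ennreal t" "0 \<le> t" "0 < q"
  shows "x \<le> ennreal (t powr q)"
proof -
  have fin: "x \<noteq> \<infinity>" using assms(1) by (auto simp: ennpowr_def top_unique)
  then have "enn2real x powr (1 / q) \<le> t"
    using assms by (simp add: ennpowr_def)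
  then have "(enn2real x powr (1 / q)) powr q \<le> t powr q"
    using assms(3) by (intro powr_mono2) auto
  then have "enn2real x \<le> t powr q" using assms(3) by (simp add: powr_powr)
  moreover have "ennreal (enn2real x) = x" using fin by (simp add: less_top)
  ultimately show ?thesis by (metis ennreal_leI)
qed

section \<open>Boxing balls in doubling Poincare spaces\<close>

text \<open>Doubling and the Poincare inequality with fixed constants, so that the constants below can
  be explicit.\<close>
locale poincare_space =
  fixes \<mu> :: "'a::metric_space set \<Rightarrow> ennreal" and cD cp \<tau> :: real
  assumes regular: "borel_regular \<mu>"
    and ball_pos: "0 < r \<Longrightarrow> 0 < \<mu> (ball x r)"
    and ball_fin: "0 < r \<Longrightarrow> \<mu> (ball x r) < \<infinity>"
    and cD: "1 \<le> cD"
    and doubling: "0 < r \<Longrightarrow> \<mu> (ball x (2 * r)) \<le> ennreal cD * \<mu> (ball x r)"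
    and cp: "0 < cp" and \<tau>: "1 \<le> \<tau>"
    and poincare: "0 < r \<Longrightarrow> u \<in> L1 \<mu> \<Longrightarrow> upper_gradient u g \<Longrightarrow>
      (\<integral>\<^sup>+ y\<in>ball x r. e2ennreal \<bar>u y - ereal (mean_value \<mu> (ball x r) u)\<bar> \<partial>carath \<mu>) / \<mu> (ball x r)
        \<le> ennreal (cp * r) * ((\<integral>\<^sup>+ y\<in>ball x (\<tau> * r). g y \<partial>carath \<mu>) / \<mu> (ball x (\<tau> * r)))"
begin

abbreviation M where "M \<equiv> carath \<mu>"

lemma space_M [simp]: "space M = UNIV"
  by (rule space_carath_borel[OF regular])

lemma borel_sets_M: "A \<in> sets borel \<Longrightarrow> A \<in> sets M"
  using sets_borel_subset_carath[OF regular] by blast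

lemma ball_sets_M [simp]: "ball x r \<in> sets M"
  by (simp add: borel_sets_M)

lemma emeasure_M: "A \<in> sets M \<Longrightarrow> emeasure M A = \<mu> A"
  by (rule emeasure_carath_eq[OF regular])

lemma emeasure_ball: "emeasure M (ball x r) = \<mu> (ball x r)"
  by (simp add: emeasure_M)

lemma measure_ball: "0 < r \<Longrightarrow> \<mu> (ball x r) = ennreal (measure M (ball x r))"
  using ball_fin[of r x] by (simp add: emeasure_eq_ennreal_measure emeasure_ball[symmetric] less_top)

lemma measure_ball_pos: "0 < r \<Longrightarrow> 0 < measure M (ball x r)"
  using ball_pos[of r x] measure_ball[of r x] by (metis ennreal_0 measure_nonneg order_less_le)

lemma measurable_M_borel: "f \<in> borel_measurable borel \<Longrightarrow> f \<in> borel_measurable M"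
  by (rule measurable_carath_borel[OF regular])

lemma large_ball:
  assumes inf: "\<mu> UNIV = \<infinity>" and "0 < \<delta>" "c < \<infinity>"
  obtains k :: nat where "c < \<mu> (ball x (2 ^ k * \<delta>))"
proof -
  have "incseq (\<lambda>k. ball x (2 ^ k * \<delta>))"
    using \<open>0 < \<delta>\<close> by (intro incseq_SucI subset_ball) simp
  then have "(SUP k. emeasure M (ball x (2 ^ k * \<delta>))) = emeasure M (\<Union>k. ball x (2 ^ k * \<delta>))"
    by (intro SUP_emeasure_incseq) auto
  also have "(\<Union>k. ball x (2 ^ k * \<delta>)) = UNIV"
  proof -
    have "\<exists>k. dist x y < 2 ^ k * \<delta>" for y
      using real_arch_pow[of 2 "dist x y / \<delta>"] \<open>0 < \<delta>\<close> by (auto simp: field_simps)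
    then show ?thesis by auto
  qed
  also have "emeasure M UNIV = \<infinity>" using inf emeasure_M[of UNIV] sets.top[of M] by simp
  finally have sup: "(SUP k. emeasure M (ball x (2 ^ k * \<delta>))) = \<infinity>" .
  have "c < (SUP k. emeasure M (ball x (2 ^ k * \<delta>)))" unfolding sup by (rule \<open>c < \<infinity>\<close>)
  then show ?thesis using that by (auto simp: less_SUP_iff emeasure_ball)
qed

text \<open>Doubling the radius, the mean value of \<open>v\<close> starts at \<open>1\<close> and tends to \<open>0\<close>, because \<open>v\<close> is
  integrable and the measures of the balls are unbounded. At the first radius where it is at
  most \<open>1/2\<close>, it cannot have dropped below \<open>1/(2 cD)\<close>, since the integral of \<open>v\<close> over the ball of
  half the radius exceeds half of the measure of that ball.\<close>
lemma boxing_mean_radius: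
  fixes v :: "'a \<Rightarrow> real"
  assumes v [measurable]: "v \<in> borel_measurable borel" and v_nonneg: "\<And>y. 0 \<le> v y"
    and int: "(\<integral>\<^sup>+ y. ennreal (v y) \<partial>M) < \<infinity>" and inf: "\<mu> UNIV = \<infinity>"
    and \<delta>: "0 < \<delta>" and v1: "\<And>y. y \<in> ball x \<delta> \<Longrightarrow> v y = 1"
  obtains r where "\<delta> \<le> r" "1 / (2 * cD) \<le> mean_value \<mu> (ball x r) (\<lambda>y. ereal (v y))"
    "mean_value \<mu> (ball x r) (\<lambda>y. ereal (v y)) \<le> 1 / 2"
proof -
  define B where "B k = ball x (2 ^ k * \<delta>)" for k :: nat
  define b where "b k = measure M (B k)" for k
  define J where "J k = enn2real (\<integral>\<^sup>+ y\<in>B k. ennreal (v y) \<partial>M)" for k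
  have B: "B k \<in> sets M" for k by (simp add: B_def)
  have b: "\<mu> (B k) = ennreal (b k)" "0 < b k" for k
    unfolding b_def B_def using \<delta> by (auto intro!: measure_ball measure_ball_pos)
  have Jle: "(\<integral>\<^sup>+ y\<in>B k. ennreal (v y) \<partial>M) \<le> (\<integral>\<^sup>+ y. ennreal (v y) \<partial>M)" for k
    by (intro nn_integral_mono) (auto split: split_indicator)
  have J: "(\<integral>\<^sup>+ y\<in>B k. ennreal (v y) \<partial>M) = ennreal (J k)" for k
    unfolding J_def using le_less_trans[OF Jle int] by simp
  have mono: "J j \<le> J k" if "j \<le> k" for j k
  proof -
    have "B j \<subseteq> B k" unfolding B_def using that \<delta> by (intro subset_ball) (simp add: power_increasing)
    then have "ennreal (J j) \<le> ennreal (J k)"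
      unfolding J[symmetric] by (intro nn_integral_mono) (auto split: split_indicator)
    then show ?thesis by (simp add: J_def)
  qed
  have mean: "mean_value \<mu> (B k) (\<lambda>y. ereal (v y)) = J k / b k" for k
  proof -
    have [measurable]: "v \<in> borel_measurable M" "B k \<in> sets M"
      by (rule measurable_M_borel[OF v]) (rule B)
    have "(LINT y:B k|M. v y) = enn2real (\<integral>\<^sup>+ y. ennreal (indicator (B k) y * v y) \<partial>M)"
      unfolding set_lebesgue_integral_def
      by (subst integral_eq_nn_integral) (simp_all add: v_nonneg)
    also have "\<dots> = J k" unfolding J_def
      by (intro arg_cong[where f=enn2real] nn_integral_cong) (auto split: split_indicator)
    finally show ?thesis by (simp add: mean_value_def b_def)
  qed
  have "ennreal 2 * (\<integral>\<^sup>+ y. ennreal (v y) \<partial>M) < \<infinity>"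
    using int by (simp add: ennreal_mult_less_top)
  then obtain k where k: "ennreal 2 * (\<integral>\<^sup>+ y. ennreal (v y) \<partial>M) < \<mu> (B k)"
    unfolding B_def by (rule large_ball[OF inf \<delta>])
  have "ennreal 2 * ennreal (J k) \<le> ennreal 2 * (\<integral>\<^sup>+ y. ennreal (v y) \<partial>M)"
    using Jle[of k] unfolding J by (rule mult_left_mono) simp
  also have "\<dots> \<le> ennreal (b k)" using k unfolding b by (rule less_imp_le)
  finally have "ennreal (2 * J k) \<le> ennreal (b k)"
    by (simp only: ennreal_mult[symmetric] J_def enn2real_nonneg zero_le_numeral)
  then have ex: "2 * J k \<le> b k" using b(2)[of k] by simp
  define n where "n = (LEAST k. 2 * J k \<le> b k)"
  have n: "2 * J n \<le> b n" unfolding n_def using ex by (rule LeastI)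
  have "J 0 = b 0"
  proof -
    have "(\<integral>\<^sup>+ y\<in>B 0. ennreal (v y) \<partial>M) = (\<integral>\<^sup>+ y. indicator (B 0) y \<partial>M)"
      using v1 by (intro nn_integral_cong) (auto simp: B_def split: split_indicator)
    also have "\<dots> = ennreal (b 0)" using b(1)[of 0] emeasure_M[OF B] B by simp
    finally have "ennreal (J 0) = ennreal (b 0)" unfolding J .
    moreover have "0 \<le> J 0" "0 \<le> b 0" by (simp_all add: J_def b_def)
    ultimately show ?thesis by simp
  qed
  then have "n \<noteq> 0" using n b(2)[of 0] by (cases n) auto
  then obtain j where j: "n = Suc j" by (cases n) auto
  have "j < (LEAST k. 2 * J k \<le> b k)" unfolding n_def[symmetric] using j by simp
  then have "\<not> 2 * J j \<le> b j" by (rule not_less_Least)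
  then have "b j < 2 * J n" using mono[of j n] j by auto
  moreover have "b n \<le> cD * b j"
  proof -
    have "B n = ball x (2 * (2 ^ j * \<delta>))" by (simp add: B_def j mult.assoc)
    then have "ennreal (b n) \<le> ennreal cD * ennreal (b j)"
      using doubling[of "2 ^ j * \<delta>" x] \<delta> b(1)[of n] b(1)[of j] by (simp add: B_def)
    then show ?thesis using cD b(2)[of j] by (simp add: ennreal_mult[symmetric])
  qed
  moreover have "cD * b j \<le> cD * (2 * J n)" using \<open>b j < 2 * J n\<close> cD by (intro mult_left_mono) auto
  ultimately have "b n \<le> 2 * cD * J n" by simp
  then have "1 / (2 * cD) \<le> J n / b n" using cD b(2)[of n] by (simp add: field_simps)
  moreover have "J n / b n \<le> 1 / 2" using n b(2)[of n] by (simp add: field_simps)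
  moreover have "\<delta> \<le> 2 ^ n * \<delta>" using \<delta> by simp
  ultimately show ?thesis using that[of "2 ^ n * \<delta>"] mean[of n] by (simp add: B_def)
qed

text \<open>On the ball of the previous lemma \<open>v\<close> differs from its mean value by at least \<open>1/(2 cD)\<close>
  wherever \<open>v\<close> is \<open>0\<close> or \<open>1\<close>, that is, on at least half of the ball. The mean oscillation is thus
  bounded below, and the Poincare inequality turns this into a bound for the measure.\<close>
lemma boxing_radius:
  fixes v :: "'a \<Rightarrow> real"
  assumes v [measurable]: "v \<in> borel_measurable borel" and v_nonneg: "\<And>y. 0 \<le> v y"
    and int: "(\<integral>\<^sup>+ y. ennreal (v y) \<partial>M) < \<infinity>" and ug: "upper_gradient (\<lambda>y. ereal (v y)) g"
    and inf: "\<mu> UNIV = \<infinity>" and \<delta>: "0 < \<delta>" and v1: "\<And>y. y \<in> ball x \<delta> \<Longrightarrow> v y = 1"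
    and small: "emeasure M {y. v y \<noteq> 0 \<and> v y \<noteq> 1} \<le> ennreal (1 / 2) * \<mu> (ball x \<delta>)"
  obtains r where "\<delta> \<le> r"
    "\<mu> (ball x (\<tau> * r)) \<le> ennreal (4 * cD * cp * r) * (\<integral>\<^sup>+ y\<in>ball x (\<tau> * r). g y \<partial>M)"
proof -
  obtain r where r: "\<delta> \<le> r"
    and mean: "1 / (2 * cD) \<le> mean_value \<mu> (ball x r) (\<lambda>y. ereal (v y))"
      "mean_value \<mu> (ball x r) (\<lambda>y. ereal (v y)) \<le> 1 / 2"
    using boxing_mean_radius[OF v v_nonneg int inf \<delta> v1] by blast
  define a where "a = mean_value \<mu> (ball x r) (\<lambda>y. ereal (v y))"
  define S where "S = {y. v y \<noteq> 0 \<and> v y \<noteq> 1}"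
  define c where "c = 1 / (2 * cD)"
  define b where "b = measure M (ball x r)"
  define t where "t = measure M (ball x (\<tau> * r))"
  define d where "d = measure M (ball x r - S)"
  have pos: "0 < r" "0 < \<tau> * r" using r \<delta> \<tau> by auto
  have b: "\<mu> (ball x r) = ennreal b" "0 < b" and t: "\<mu> (ball x (\<tau> * r)) = ennreal t" "0 < t"
    unfolding b_def t_def using pos by (auto intro!: measure_ball measure_ball_pos)
  have "S \<in> sets borel" unfolding S_def by measurable
  then have S: "S \<in> sets M" by (rule borel_sets_M)
  have "emeasure M (ball x r - S) \<le> ennreal b"
    using emeasure_mono[of "ball x r - S" "ball x r" M] emeasure_ball[of x r] b by simp
  then have "emeasure M (ball x r - S) < \<infinity>" by (rule le_less_trans) simp
  then have d: "emeasure M (ball x r - S) = ennreal d"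
    unfolding d_def by (simp add: emeasure_eq_ennreal_measure less_top)
  have "emeasure M S \<le> ennreal (b / 2)"
  proof -
    have "emeasure M S \<le> ennreal (1 / 2) * \<mu> (ball x \<delta>)" using small by (simp add: S_def)
    also have "\<dots> \<le> ennreal (1 / 2) * \<mu> (ball x r)"
      using emeasure_mono[of "ball x \<delta>" "ball x r" M] subset_ball[OF r]
      by (intro mult_left_mono) (auto simp: emeasure_ball)
    also have "\<dots> = ennreal (b / 2)"
      using ennreal_mult[of "1 / 2" b] b by simp
    finally show ?thesis .
  qed
  moreover have "emeasure M (ball x r) \<le> emeasure M (ball x r - S) + emeasure M S"
    using S by (intro order_trans[OF emeasure_mono emeasure_subadditive]) auto
  ultimately have "ennreal b \<le> ennreal d + ennreal (b / 2)"
    unfolding d emeasure_ball b(1) by (meson add_left_mono order_trans)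
  then have db: "b / 2 \<le> d"
    using b(2) by (simp add: d_def ennreal_plus[symmetric] del: ennreal_plus)
  have c: "0 < c" "c \<le> 1 / 2" using cD by (auto simp: c_def field_simps)
  \<comment> \<open>Where \<open>v = 1\<close> the distance to the mean value is at least \<open>1/2\<close>, where \<open>v = 0\<close> it is at least
    \<open>c\<close>, and \<open>c \<le> 1/2\<close>.\<close>
  have away: "ennreal c * indicator (ball x r - S) y \<le>
      e2ennreal \<bar>ereal (v y) - ereal a\<bar> * indicator (ball x r) y" for y
  proof (cases "y \<in> ball x r - S")
    case True
    then have "c \<le> \<bar>v y - a\<bar>" using mean c by (auto simp: S_def a_def c_def)
    then show ?thesis using True by (simp add: ennreal_leI)
  qed simp
  have "ennreal (c * d) = (\<integral>\<^sup>+ y. ennreal c * indicator (ball x r - S) y \<partial>M)"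
    using S c measure_nonneg[of M "ball x r - S"]
    by (subst nn_integral_cmult_indicator) (auto simp: d ennreal_mult d_def)
  also have "\<dots> \<le> (\<integral>\<^sup>+ y\<in>ball x r. e2ennreal \<bar>ereal (v y) - ereal a\<bar> \<partial>M)"
    by (intro nn_integral_mono away)
  finally have "ennreal (c * d) / ennreal b \<le>
      (\<integral>\<^sup>+ y\<in>ball x r. e2ennreal \<bar>ereal (v y) - ereal a\<bar> \<partial>M) / ennreal b"
    by (rule divide_right_mono_ennreal)
  also have "\<dots> \<le> ennreal (cp * r) * ((\<integral>\<^sup>+ y\<in>ball x (\<tau> * r). g y \<partial>M) / ennreal t)"
  proof -
    have "(\<lambda>y. ereal (v y)) \<in> L1 \<mu>"
      using int v_nonneg measurable_M_borel[OF v] by (simp add: L1_def)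
    from poincare[OF pos(1) this ug, of x] show ?thesis by (simp add: a_def b t)
  qed
  finally have key: "ennreal (c * d / b) \<le> ennreal (cp * r) * ((\<integral>\<^sup>+ y\<in>ball x (\<tau> * r). g y \<partial>M) / ennreal t)"
    using b(2) c by (simp add: divide_ennreal d_def)
  have "\<mu> (ball x (\<tau> * r)) \<le> ennreal (4 * cD * cp * r) * (\<integral>\<^sup>+ y\<in>ball x (\<tau> * r). g y \<partial>M)"
  proof (cases "\<integral>\<^sup>+ y\<in>ball x (\<tau> * r). g y \<partial>M")
    case (real G)
    have "c / 2 \<le> c * d / b" using db b(2) c by (simp add: field_simps)
    moreover have "c * d / b \<le> cp * r * (G / t)"
      using key real t(2) cp pos by (simp add: divide_ennreal ennreal_mult[symmetric])
    ultimately have "1 / (4 * cD) \<le> cp * r * (G / t)" by (simp add: c_def)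
    then have "t \<le> 4 * cD * cp * r * G" using cD t(2) by (simp add: field_simps)
    then show ?thesis using real t cD cp pos by (simp add: ennreal_mult[symmetric] ennreal_leI)
  next
    case top
    have "0 < 4 * cD * cp * r" using cD cp pos by simp
    then have "ennreal (4 * cD * cp * r) \<noteq> 0" by (metis ennreal_eq_0_iff not_le)
    then show ?thesis unfolding top by (simp only: ennreal_mult_top if_False top_greatest)
  qed
  with r show ?thesis by (rule that)
qed

lemma doubling_power:
  assumes "0 < r"
  shows "\<mu> (ball x (2 ^ n * r)) \<le> ennreal (cD ^ n) * \<mu> (ball x r)"
proof (induction n)
  case (Suc n)
  have "\<mu> (ball x (2 ^ Suc n * r)) \<le> ennreal cD * \<mu> (ball x (2 ^ n * r))"
    using doubling[of "2 ^ n * r" x] assms by (simp add: mult.assoc)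
  also have "\<dots> \<le> ennreal cD * (ennreal (cD ^ n) * \<mu> (ball x r))"
    by (intro mult_left_mono Suc.IH) simp
  also have "\<dots> = ennreal (cD ^ Suc n) * \<mu> (ball x r)"
    using cD by (simp add: ennreal_mult mult.assoc)
  finally show ?case .
qed simp

text \<open>The factor \<open>3\<close> is the enlargement in the covering lemma. The test function for the enlarged
  ball needs radius \<open>9 r \<le> 2\<^sup>4 r\<close>.\<close>
lemma cap1_ball_enlarged_le:
  assumes "0 < r"
  shows "cap1 \<mu> (ball x (3 * r)) \<le> ennreal (cD ^ 4 / r) * \<mu> (ball x r)"
proof -
  have "cap1 \<mu> (ball x (3 * r)) \<le> ennreal (1 / (3 * r)) * \<mu> (ball x (3 * (3 * r)))"
    using assms by (intro cap1_ball_le[OF regular ball_fin]) auto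
  also have "\<dots> \<le> ennreal (1 / r) * \<mu> (ball x (2 ^ 4 * r))"
  proof (intro mult_mono ennreal_leI)
    show "\<mu> (ball x (3 * (3 * r))) \<le> \<mu> (ball x (2 ^ 4 * r))"
      using assms emeasure_mono[OF subset_ball, of "3 * (3 * r)" "2 ^ 4 * r" x M] by (simp add: emeasure_ball)
  qed (use assms in \<open>auto simp: field_simps\<close>)
  also have "\<dots> \<le> ennreal (1 / r) * (ennreal (cD ^ 4) * \<mu> (ball x r))"
    by (intro mult_left_mono doubling_power assms) simp
  also have "\<dots> = ennreal (cD ^ 4 / r) * \<mu> (ball x r)"
    using assms cD by (simp add: ennreal_mult[symmetric] mult.assoc[symmetric])
  finally show ?thesis .
qed

end

section \<open>From capacitary bounds on balls to the Sobolev inequality\<close>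

locale capacitary_measure = poincare_space \<mu> cD cp \<tau>
  for \<mu> :: "'a::metric_space set \<Rightarrow> ennreal" and cD cp \<tau> +
  fixes \<nu> :: "'a set \<Rightarrow> ennreal" and q \<gamma> :: real
  assumes \<nu>_regular: "borel_regular \<nu>" and q: "1 \<le> q" and \<gamma>: "0 \<le> \<gamma>"
    and capacity: "0 < r \<Longrightarrow> ennpowr (\<nu> (ball x r)) (1 / q) \<le> ennreal \<gamma> * cap1 \<mu> (ball x r)"
begin

abbreviation N where "N \<equiv> carath \<nu>"

lemma borel_sets_N: "A \<in> sets borel \<Longrightarrow> A \<in> sets N"
  using sets_borel_subset_carath[OF \<nu>_regular] by blast

lemma emeasure_N: "A \<in> sets borel \<Longrightarrow> emeasure N A = \<nu> A"
  by (intro emeasure_carath_eq[OF \<nu>_regular] borel_sets_N)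

lemma \<nu>_ball_le:
  assumes "0 < r" "cap1 \<mu> (ball x r) \<le> ennreal t" "0 \<le> t"
  shows "\<nu> (ball x r) \<le> ennreal ((\<gamma> * t) powr q)"
proof (rule ennpowr_inverse_leD)
  have "ennpowr (\<nu> (ball x r)) (1 / q) \<le> ennreal \<gamma> * ennreal t"
    using capacity[OF assms(1), of x] assms(2) by (meson mult_left_mono order_trans zero_le)
  then show "ennpowr (\<nu> (ball x r)) (1 / q) \<le> ennreal (\<gamma> * t)"
    using \<gamma> assms(3) by (simp add: ennreal_mult)
qed (use q \<gamma> assms in auto)

text \<open>The constant of the weak type estimate for a slab: \<open>\<gamma>\<close> times the constants of
  \<open>boxing_radius\<close> and \<open>cap1_ball_enlarged_le\<close> for the radii \<open>r\<close> and \<open>\<tau> r\<close>.\<close>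
definition cap_const where "cap_const = \<gamma> * (4 * cD ^ 5 * cp / \<tau>)"

lemma cap_const_nonneg: "0 \<le> cap_const"
  using \<gamma> cD cp \<tau> by (simp add: cap_const_def)

text \<open>The energy \<open>A \<mapsto> \<integral>\<^sub>A g d\<mu>\<close> is handled as a finite measure, which allows real arithmetic.\<close>
lemma density_finite:
  assumes "g \<in> borel_measurable borel" "(\<integral>\<^sup>+ x. g x \<partial>M) < \<infinity>"
  shows "finite_measure (density M g)"
    and "A \<in> sets borel \<Longrightarrow> (\<integral>\<^sup>+ x\<in>A. g x \<partial>M) = ennreal (measure (density M g) A)"
proof -
  have g: "g \<in> borel_measurable M" by (rule measurable_M_borel[OF assms(1)])
  have dens: "emeasure (density M g) A = (\<integral>\<^sup>+ x\<in>A. g x \<partial>M)" if "A \<in> sets borel" for A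
    by (rule emeasure_density[OF g borel_sets_M[OF that]])
  have "emeasure (density M g) (space (density M g)) = (\<integral>\<^sup>+ x. g x \<partial>M)"
    using dens[of UNIV] by simp
  then show fin: "finite_measure (density M g)"
    using assms(2) by (intro finite_measureI) simp
  show "(\<integral>\<^sup>+ x\<in>A. g x \<partial>M) = ennreal (measure (density M g) A)" if "A \<in> sets borel"
    unfolding dens[OF that, symmetric] by (rule finite_measure.emeasure_eq_measure[OF fin])
qed

text \<open>Boxing balls of the truncation to the slab are selected by Vitali's lemma. Their capacities
  are bounded by the energies of disjoint parts of the slab, and \<open>\<Sum> a\<^sub>i\<^sup>q \<le> (\<Sum> a\<^sub>i)\<^sup>q\<close> allows
  adding up the bounds for \<open>\<nu>\<close>.\<close>
lemma slab_estimate: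
  fixes f :: "'a \<Rightarrow> real"
  assumes f: "continuous_on UNIV f" and ug: "upper_gradient (\<lambda>x. ereal (f x)) g"
    and g: "(\<integral>\<^sup>+ x. g x \<partial>M) < \<infinity>" and inf: "\<mu> UNIV = \<infinity>"
    and K: "compact K" and h: "0 < h" and \<delta>: "0 < \<delta>"
    and above: "\<And>x y. x \<in> K \<Longrightarrow> y \<in> ball x \<delta> \<Longrightarrow> s + h \<le> f y"
    and supp: "emeasure M {x. s \<le> f x} < \<infinity>"
    and small: "\<And>x. x \<in> K \<Longrightarrow>
      emeasure M {y. s \<le> f y \<and> f y \<le> s + h} \<le> ennreal (1 / 2) * \<mu> (ball x \<delta>)"
  shows "\<nu> K \<le> ennreal ((cap_const / h * measure (density M g) {y. s \<le> f y \<and> f y \<le> s + h}) powr q)"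
proof -
  define S where "S = {y. s \<le> f y \<and> f y \<le> s + h}"
  define v where "v y = 1 / h * max s (min (s + h) (f y)) + - s / h" for y
  define gv where "gv y = ennreal \<bar>1 / h\<bar> * (g y * indicator S y)" for y
  define G where "G A = measure (density M g) A" for A
  have [measurable]: "f \<in> borel_measurable borel" using f by (rule borel_measurable_continuous_onI)
  have gb: "g \<in> borel_measurable borel" using ug by (simp add: upper_gradient_def)
  note dens = density_finite[OF gb g]
  have S [measurable]: "S \<in> sets borel" unfolding S_def by measurable
  have vb [measurable]: "v \<in> borel_measurable borel" unfolding v_def by measurable
  have v: "v y = 0 \<longleftrightarrow> f y \<le> s" "v y = 1 \<longleftrightarrow> s + h \<le> f y" "0 \<le> v y" "v y \<le> 1" for y
    using h by (auto simp: v_def field_simps max_def min_def)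
  have ugv: "upper_gradient (\<lambda>y. ereal (v y)) gv"
    unfolding v_def gv_def S_def
    using h by (intro upper_gradient_affine upper_gradient_truncation[OF ug f]) simp
  have "(\<integral>\<^sup>+ y. ennreal (v y) \<partial>M) \<le> (\<integral>\<^sup>+ y. indicator {x. s \<le> f x} y \<partial>M)"
  proof (rule nn_integral_mono)
    fix y
    show "ennreal (v y) \<le> indicator {x. s \<le> f x} y"
      using v[of y] by (cases "s \<le> f y") auto
  qed
  also have "\<dots> = emeasure M {x. s \<le> f x}"
    by (intro nn_integral_indicator borel_sets_M) measurable
  finally have vint: "(\<integral>\<^sup>+ y. ennreal (v y) \<partial>M) < \<infinity>" using supp by (rule le_less_trans)
  have "\<exists>r>0. \<mu> (ball x (\<tau> * r)) \<le> ennreal (4 * cD * cp * r) * (\<integral>\<^sup>+ y\<in>ball x (\<tau> * r). gv y \<partial>M)"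
    if x: "x \<in> K" for x
  proof -
    have "emeasure M {y. v y \<noteq> 0 \<and> v y \<noteq> 1} \<le> emeasure M S"
      using v by (intro emeasure_mono borel_sets_M S) (auto simp: S_def)
    also have "\<dots> \<le> ennreal (1 / 2) * \<mu> (ball x \<delta>)" unfolding S_def by (rule small[OF x])
    finally have sm: "emeasure M {y. v y \<noteq> 0 \<and> v y \<noteq> 1} \<le> ennreal (1 / 2) * \<mu> (ball x \<delta>)" .
    have v1: "v y = 1" if "y \<in> ball x \<delta>" for y using above[OF x that] v(2) by simp
    obtain r where "\<delta> \<le> r"
      "\<mu> (ball x (\<tau> * r)) \<le> ennreal (4 * cD * cp * r) * (\<integral>\<^sup>+ y\<in>ball x (\<tau> * r). gv y \<partial>M)"
      by (rule boxing_radius[OF vb v(3) vint ugv inf \<delta> v1 sm])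
    then show ?thesis using \<delta> by (intro exI[of _ r]) auto
  qed
  then obtain \<rho> where \<rho>: "\<And>x. x \<in> K \<Longrightarrow> 0 < \<rho> x"
    "\<And>x. x \<in> K \<Longrightarrow> \<mu> (ball x (\<tau> * \<rho> x)) \<le>
        ennreal (4 * cD * cp * \<rho> x) * (\<integral>\<^sup>+ y\<in>ball x (\<tau> * \<rho> x). gv y \<partial>M)"
    by metis
  obtain F where F: "finite F" "F \<subseteq> K" "disjoint_family_on (\<lambda>x. ball x (\<tau> * \<rho> x)) F"
    "K \<subseteq> (\<Union>x\<in>F. ball x (3 * (\<tau> * \<rho> x)))"
    by (rule compact_Vitali[OF K, of "\<lambda>x. \<tau> * \<rho> x"]) (use \<rho>(1) \<tau> in auto)
  have ball_est: "\<nu> (ball x (3 * (\<tau> * \<rho> x))) \<le> ennreal ((cap_const / h * G (ball x (\<tau> * \<rho> x) \<inter> S)) powr q)"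
    if "x \<in> F" for x
  proof -
    have x: "x \<in> K" using that F(2) by auto
    let ?B = "ball x (\<tau> * \<rho> x)"
    have pos: "0 < \<rho> x" "0 < \<tau> * \<rho> x" using \<rho>(1)[OF x] \<tau> by auto
    have G0: "0 \<le> G (?B \<inter> S)" by (simp add: G_def)
    have "(\<integral>\<^sup>+ y\<in>?B. gv y \<partial>M) = (\<integral>\<^sup>+ y. ennreal (1 / h) * (g y * indicator (?B \<inter> S) y) \<partial>M)"
      using h by (intro nn_integral_cong) (auto simp: gv_def split: split_indicator)
    also have "\<dots> = ennreal (1 / h) * (\<integral>\<^sup>+ y\<in>?B \<inter> S. g y \<partial>M)"
      using gb S by (intro nn_integral_cmult measurable_M_borel borel_measurable_times_ennreal
          borel_measurable_indicator) auto
    also have "\<dots> = ennreal (1 / h * G (?B \<inter> S))"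
      using ennreal_mult[of "1 / h" "G (?B \<inter> S)"] h G0 dens(2)[of "?B \<inter> S"] by (simp add: G_def)
    finally have I: "(\<integral>\<^sup>+ y\<in>?B. gv y \<partial>M) = ennreal (1 / h * G (?B \<inter> S))" .
    have "cap1 \<mu> (ball x (3 * (\<tau> * \<rho> x))) \<le> ennreal (cD ^ 4 / (\<tau> * \<rho> x)) * \<mu> ?B"
      by (rule cap1_ball_enlarged_le[OF pos(2)])
    also have "\<dots> \<le> ennreal (cD ^ 4 / (\<tau> * \<rho> x)) * (ennreal (4 * cD * cp * \<rho> x) * ennreal (1 / h * G (?B \<inter> S)))"
      using \<rho>(2)[OF x] unfolding I by (intro mult_left_mono) auto
    also have "\<dots> = ennreal (cD ^ 4 / (\<tau> * \<rho> x) * (4 * cD * cp * \<rho> x * (1 / h * G (?B \<inter> S))))"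
    proof -
      have "0 \<le> cD ^ 4 / (\<tau> * \<rho> x)" "0 \<le> 4 * cD * cp * \<rho> x" "0 \<le> 1 / h * G (?B \<inter> S)"
        using pos cD cp h G0 by auto
      then show ?thesis by (simp only: ennreal_mult mult_nonneg_nonneg)
    qed
    also have "cD ^ 4 / (\<tau> * \<rho> x) * (4 * cD * cp * \<rho> x * (1 / h * G (?B \<inter> S)))
        = 4 * cD ^ 5 * cp / \<tau> / h * G (?B \<inter> S)"
      using pos \<tau> h by (simp add: field_simps eval_nat_numeral)
    finally have "cap1 \<mu> (ball x (3 * (\<tau> * \<rho> x))) \<le> ennreal (4 * cD ^ 5 * cp / \<tau> / h * G (?B \<inter> S))" .
    then have "\<nu> (ball x (3 * (\<tau> * \<rho> x))) \<le> ennreal ((\<gamma> * (4 * cD ^ 5 * cp / \<tau> / h * G (?B \<inter> S))) powr q)"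
      using pos cD cp \<tau> h G0 by (intro \<nu>_ball_le) auto
    then show ?thesis by (simp add: cap_const_def mult.assoc)
  qed
  have "\<nu> K = emeasure N K" using K by (simp add: emeasure_N borel_compact)
  also have "\<dots> \<le> emeasure N (\<Union>x\<in>F. ball x (3 * (\<tau> * \<rho> x)))"
    using F(4) by (intro emeasure_mono borel_sets_N borel_open open_UN) auto
  also have "\<dots> \<le> (\<Sum>x\<in>F. emeasure N (ball x (3 * (\<tau> * \<rho> x))))"
    using F(1) by (intro emeasure_subadditive_finite) (auto intro!: borel_sets_N)
  also have "\<dots> \<le> (\<Sum>x\<in>F. ennreal ((cap_const / h * G (ball x (\<tau> * \<rho> x) \<inter> S)) powr q))"
    using ball_est by (intro sum_mono) (simp add: emeasure_N)
  also have "\<dots> = ennreal (\<Sum>x\<in>F. (cap_const / h * G (ball x (\<tau> * \<rho> x) \<inter> S)) powr q)"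
    by (intro sum_ennreal) simp
  also have "\<dots> \<le> ennreal ((\<Sum>x\<in>F. cap_const / h * G (ball x (\<tau> * \<rho> x) \<inter> S)) powr q)"
    using cap_const_nonneg h q F(1) by (intro ennreal_leI sum_powr_le_powr_sum) (auto simp: G_def)
  also have "\<dots> \<le> ennreal ((cap_const / h * G S) powr q)"
  proof (intro ennreal_leI powr_mono2)
    have "(\<Sum>x\<in>F. G (ball x (\<tau> * \<rho> x) \<inter> S)) = G (\<Union>x\<in>F. ball x (\<tau> * \<rho> x) \<inter> S)"
      unfolding G_def using F(1,3)
      by (intro finite_measure.finite_measure_finite_Union[OF dens(1), symmetric])
        (auto simp: disjoint_family_on_def intro!: borel_sets_M)
    also have "\<dots> \<le> G S"
      unfolding G_def by (intro finite_measure.finite_measure_mono[OF dens(1)]) (auto intro!: borel_sets_M)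
    finally show "(\<Sum>x\<in>F. cap_const / h * G (ball x (\<tau> * \<rho> x) \<inter> S)) \<le> cap_const / h * G S"
      unfolding sum_distrib_left[symmetric] using cap_const_nonneg h by (intro mult_left_mono) auto
    show "0 \<le> (\<Sum>x\<in>F. cap_const / h * G (ball x (\<tau> * \<rho> x) \<inter> S))"
      using cap_const_nonneg h by (intro sum_nonneg) (auto simp: G_def)
  qed (use q in simp)
  finally show ?thesis by (simp only: G_def S_def)
qed

lemma ball_lower_bound:
  assumes "compact K" "0 < \<delta>"
  obtains m where "0 < m" "\<And>x. x \<in> K \<Longrightarrow> ennreal m \<le> \<mu> (ball x \<delta>)"
proof -
  have "K \<subseteq> (\<Union>x\<in>K. ball x (\<delta> / 2))" using assms(2) by force
  then obtain C where C: "C \<subseteq> K" "finite C" "K \<subseteq> (\<Union>x\<in>C. ball x (\<delta> / 2))"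
    using compactE_image[OF assms(1), of K "\<lambda>x. ball x (\<delta> / 2)"] by blast
  define m where "m = Min (insert 1 ((\<lambda>x. measure M (ball x (\<delta> / 2))) ` C))"
  have "0 < m" unfolding m_def using C(2) assms(2) by (auto intro: measure_ball_pos)
  moreover have "ennreal m \<le> \<mu> (ball x \<delta>)" if x: "x \<in> K" for x
  proof -
    obtain c where c: "c \<in> C" "x \<in> ball c (\<delta> / 2)" using C(3) x by blast
    have "m \<le> measure M (ball c (\<delta> / 2))" unfolding m_def using C(2) c(1) by (intro Min_le) auto
    then have "ennreal m \<le> \<mu> (ball c (\<delta> / 2))"
      using assms(2) by (simp add: measure_ball ennreal_leI)
    also have "\<dots> \<le> \<mu> (ball x \<delta>)"
    proof -
      have "ball c (\<delta> / 2) \<subseteq> ball x \<delta>"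
      proof
        fix y assume "y \<in> ball c (\<delta> / 2)"
        then show "y \<in> ball x \<delta>" using c(2) dist_triangle[of x y c] by (simp add: dist_commute)
      qed
      then show ?thesis unfolding emeasure_ball[symmetric] by (rule emeasure_mono) simp
    qed
    finally show ?thesis .
  qed
  ultimately show ?thesis by (rule that)
qed

text \<open>The slope of the truncation to a slab of height \<open>\<alpha> / (4 n)\<close> is compensated by choosing,
  among \<open>n\<close> disjoint slabs, one that has at most the fraction \<open>2 / n\<close> of the energy; the
  result does not depend on \<open>n\<close>. Hence \<open>n\<close> may be taken large enough for the slab to satisfy the
  smallness condition of \<open>slab_estimate\<close>, whose threshold depends on \<open>f\<close> and \<open>\<alpha>\<close>.\<close>
lemma level_estimate:
  fixes f :: "'a \<Rightarrow> real"
  assumes f: "continuous_on UNIV f" and ug: "upper_gradient (\<lambda>x. ereal (f x)) g"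
    and g: "(\<integral>\<^sup>+ x. g x \<partial>M) < \<infinity>" and inf: "\<mu> UNIV = \<infinity>"
    and \<alpha>: "0 < \<alpha>" and K: "compact {x. 2 * \<alpha> \<le> f x}" and supp: "emeasure M {x. \<alpha> \<le> f x} < \<infinity>"
  shows "\<nu> {x. 2 * \<alpha> \<le> f x} \<le>
    ennreal ((8 * cap_const / \<alpha> * measure (density M g) {x. \<alpha> \<le> f x \<and> f x \<le> 3 / 2 * \<alpha>}) powr q)"
proof -
  let ?K = "{x. 2 * \<alpha> \<le> f x}" and ?T = "{x. \<alpha> \<le> f x \<and> f x \<le> 3 / 2 * \<alpha>}"
  define G where "G A = measure (density M g) A" for A
  have [measurable]: "f \<in> borel_measurable borel" using f by (rule borel_measurable_continuous_onI)
  have gb: "g \<in> borel_measurable borel" using ug by (simp add: upper_gradient_def)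
  note dens = density_finite[OF gb g]
  have "open {x. 3 / 2 * \<alpha> < f x}" using f by (intro open_Collect_less) auto
  moreover have "?K \<subseteq> {x. 3 / 2 * \<alpha> < f x}" using \<alpha> by auto
  ultimately obtain \<delta> where \<delta>: "0 < \<delta>" "(\<Union>x\<in>?K. ball x \<delta>) \<subseteq> {x. 3 / 2 * \<alpha> < f x}"
    using compact_subset_open_imp_ball_epsilon_subset[OF K] by blast
  obtain m where m: "0 < m" "\<And>x. x \<in> ?K \<Longrightarrow> ennreal m \<le> \<mu> (ball x \<delta>)"
    using ball_lower_bound[OF K \<delta>(1)] by blast
  define M0 where "M0 = measure M {x. \<alpha> \<le> f x}"
  obtain n where "2 * M0 / (m / 2) < real n" using reals_Archimedean2 by blast
  then have n: "2 * M0 < real n * (m / 2)" using m(1) by (simp add: field_simps)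
  then have "0 < n" using m(1) measure_nonneg[of M "{x. \<alpha> \<le> f x}"] by (cases n) (auto simp: M0_def)
  define h where "h = \<alpha> / (4 * real n)"
  have h: "0 < h" "4 * real n * h = \<alpha>" using \<alpha> \<open>0 < n\<close> by (auto simp: h_def)
  \<comment> \<open>Consecutive slabs are separated by gaps of their own height \<open>h\<close>: truncation gives upper
    gradients supported in closed slabs, and these have to be disjoint.\<close>
  define s where "s j = \<alpha> + 2 * real j * h" for j
  define S where "S j = {y. s j \<le> f y \<and> f y \<le> s j + h}" for j
  have s_up: "s j + h \<le> 3 / 2 * \<alpha>" if "j < n" for j
  proof -
    have "real (Suc j) * h \<le> real n * h" using that h(1) by (intro mult_right_mono) auto
    then show ?thesis using h by (simp add: s_def algebra_simps)
  qed
  have s_lo: "\<alpha> \<le> s j" for j using h by (simp add: s_def)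
  have S [measurable]: "S j \<in> sets borel" for j unfolding S_def by measurable
  have ST: "S j \<subseteq> ?T" if "j < n" for j
    using s_up[OF that] s_lo[of j] by (auto simp: S_def)
  have gap: "s i + h < s j" if "i < j" for i j
  proof -
    have "real (Suc i) * h \<le> real j * h" using that h(1) by (intro mult_right_mono) auto
    then show ?thesis using h(1) by (simp add: s_def algebra_simps)
  qed
  have disj: "disjoint_family_on S {..<n}"
    unfolding disjoint_family_on_def
  proof (intro ballI impI)
    fix i j :: nat assume "i \<noteq> j"
    then show "S i \<inter> S j = {}"
      using gap[of i j] gap[of j i] by (cases "i < j") (auto simp: S_def)
  qed
  have supp': "emeasure M (S j) \<le> emeasure M {x. \<alpha> \<le> f x}" for j
    using s_lo[of j] by (intro emeasure_mono borel_sets_M) (auto simp: S_def)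
  have Sfin: "emeasure M (S j) = ennreal (measure M (S j))" for j
    using le_less_trans[OF supp'[of j] supp] by (simp add: emeasure_eq_ennreal_measure less_top)
  have "ennreal (\<Sum>j<n. measure M (S j)) = (\<Sum>j<n. emeasure M (S j))"
    by (simp add: Sfin sum_ennreal)
  also have "\<dots> = emeasure M (\<Union>j<n. S j)"
    using disj by (intro sum_emeasure) (auto intro!: borel_sets_M)
  also have "\<dots> \<le> emeasure M {x. \<alpha> \<le> f x}"
    using s_lo by (intro emeasure_mono borel_sets_M) (auto simp: S_def intro: order_trans)
  also have "\<dots> = ennreal M0" unfolding M0_def using supp by (simp add: emeasure_eq_ennreal_measure less_top)
  finally have sum1: "(\<Sum>j<n. measure M (S j)) \<le> M0" by (simp add: M0_def)
  have "(\<Sum>j<n. G (S j)) = G (\<Union>j<n. S j)"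
    unfolding G_def using disj
    by (intro finite_measure.finite_measure_finite_Union[OF dens(1), symmetric]) (auto intro!: borel_sets_M)
  also have "\<dots> \<le> G ?T"
    unfolding G_def using ST by (intro finite_measure.finite_measure_mono[OF dens(1)]) (auto intro!: borel_sets_M)
  finally have sum2: "(\<Sum>j<n. G (S j)) \<le> G ?T" .
  obtain j where j: "j < n" "measure M (S j) \<le> m / 2" "real n * G (S j) \<le> 2 * G ?T"
    by (rule ex_small_pair[OF _ sum1 _ sum2 _ n]) (use m in \<open>auto simp: G_def\<close>)
  have "\<nu> ?K \<le> ennreal ((cap_const / h * measure (density M g) {y. s j \<le> f y \<and> f y \<le> s j + h}) powr q)"
  proof (rule slab_estimate[OF f ug g inf K h(1) \<delta>(1)])
    show "s j + h \<le> f y" if "x \<in> ?K" "y \<in> ball x \<delta>" for x y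
    proof -
      have "3 / 2 * \<alpha> < f y" using \<delta>(2) that by blast
      then show ?thesis using s_up[OF j(1)] by linarith
    qed
    have "emeasure M {x. s j \<le> f x} \<le> emeasure M {x. \<alpha> \<le> f x}"
      using s_lo[of j] by (intro emeasure_mono borel_sets_M) auto
    then show "emeasure M {x. s j \<le> f x} < \<infinity>" using supp by (rule le_less_trans)
    show "emeasure M {y. s j \<le> f y \<and> f y \<le> s j + h} \<le> ennreal (1 / 2) * \<mu> (ball x \<delta>)" if "x \<in> ?K" for x
    proof -
      have "emeasure M (S j) \<le> ennreal (1 / 2 * m)" unfolding Sfin using j(2) by (intro ennreal_leI) simp
      also have "\<dots> = ennreal (1 / 2) * ennreal m" using m(1) by (intro ennreal_mult) auto
      also have "\<dots> \<le> ennreal (1 / 2) * \<mu> (ball x \<delta>)" by (intro mult_left_mono m(2) that) simp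
      finally show ?thesis by (simp only: S_def)
    qed
  qed
  also have "\<dots> \<le> ennreal ((8 * cap_const / \<alpha> * G ?T) powr q)"
  proof (intro ennreal_leI powr_mono2)
    have "cap_const / h * G (S j) = cap_const * (4 / \<alpha>) * (real n * G (S j))"
      using \<open>0 < n\<close> \<alpha> by (simp add: h_def field_simps)
    also have "\<dots> \<le> cap_const * (4 / \<alpha>) * (2 * G ?T)"
      using cap_const_nonneg \<alpha> by (intro mult_left_mono j(3)) auto
    finally show "cap_const / h * measure (density M g) {y. s j \<le> f y \<and> f y \<le> s j + h} \<le> 8 * cap_const / \<alpha> * G ?T"
      by (simp add: G_def S_def)
  qed (use q cap_const_nonneg h in auto)
  finally show ?thesis by (simp only: G_def)
qed

text \<open>With \<open>\<alpha> k = U / 2\<^sup>k / 4\<close> and \<open>U \<ge> f\<close>, each positive value of \<open>f\<close> lies in some interval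
  \<open>[2 \<alpha> k, 4 \<alpha> k]\<close>, so that \<open>f\<^sup>q\<close> is dominated by a series of indicators of superlevel sets.\<close>
lemma capacitary_strong_type:
  fixes u :: "'a \<Rightarrow> real"
  assumes u: "u \<in> C0" and ug: "upper_gradient (\<lambda>x. ereal (u x)) g"
    and g: "(\<integral>\<^sup>+ x. g x \<partial>M) < \<infinity>" and inf: "\<mu> UNIV = \<infinity>"
  shows "(\<integral>\<^sup>+ x. ennreal (\<bar>u x\<bar> powr q) \<partial>N) \<le> ennreal ((32 * cap_const * enn2real (\<integral>\<^sup>+ x. g x \<partial>M)) powr q)"
proof -
  define f where "f x = \<bar>u x\<bar>" for x
  have uc: "continuous_on UNIV u" and supp: "compact (closure {x. u x \<noteq> 0})" using u by (auto simp: C0_def)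
  have f: "continuous_on UNIV f" unfolding f_def using uc by (intro continuous_intros)
  have [measurable]: "f \<in> borel_measurable borel" using f by (rule borel_measurable_continuous_onI)
  have ugf: "upper_gradient (\<lambda>x. ereal (f x)) g" unfolding f_def by (rule upper_gradient_abs[OF ug])
  have gb: "g \<in> borel_measurable borel" using ug by (simp add: upper_gradient_def)
  note dens = density_finite[OF gb g]
  define G where "G A = measure (density M g) A" for A
  have "compact (f ` closure {x. u x \<noteq> 0})"
    using f supp by (intro compact_continuous_image) (auto intro: continuous_on_subset)
  then obtain U' where U': "\<And>x. x \<in> closure {x. u x \<noteq> 0} \<Longrightarrow> f x \<le> U'"
    using compact_imp_bounded bounded_iff by (metis abs_le_D1 image_eqI real_norm_def)
  define U where "U = max 1 U'"
  have U: "0 < U" "f x \<le> U" for x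
  proof -
    show "0 < U" by (simp add: U_def)
    show "f x \<le> U"
    proof (cases "u x = 0")
      case False
      then have "x \<in> closure {x. u x \<noteq> 0}" using closure_subset by fast
      then show ?thesis using U' by (simp add: U_def le_max_iff_disj)
    qed (simp add: U_def f_def)
  qed
  have upper: "compact {x. c \<le> f x}" "emeasure M {x. c \<le> f x} < \<infinity>" if c: "0 < c" for c
  proof -
    have "{x. c \<le> f x} \<subseteq> closure {x. u x \<noteq> 0}"
      using c closure_subset[of "{x. u x \<noteq> 0}"] by (auto simp: f_def)
    moreover have "closed {x. c \<le> f x}" using f by (intro closed_Collect_le) auto
    ultimately show cp: "compact {x. c \<le> f x}"
      using compact_Int_closed[OF supp, of "{x. c \<le> f x}"] by (simp add: Int_absorb1)
    fix x0 :: 'a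
    obtain R where R: "0 < R" "{x. c \<le> f x} \<subseteq> ball x0 R"
      using bounded_subset_ballD[OF compact_imp_bounded[OF cp]] by metis
    then have "emeasure M {x. c \<le> f x} \<le> \<mu> (ball x0 R)"
      unfolding emeasure_ball[symmetric] by (intro emeasure_mono) auto
    then show "emeasure M {x. c \<le> f x} < \<infinity>" using ball_fin[OF R(1)] by (rule le_less_trans)
  qed
  define \<alpha> where "\<alpha> k = U / 2 ^ k / 4" for k :: nat
  have \<alpha>: "0 < \<alpha> k" for k using U by (simp add: \<alpha>_def)
  define K where "K k = {x. 2 * \<alpha> k \<le> f x}" for k
  define T where "T k = {x. \<alpha> k \<le> f x \<and> f x \<le> 3 / 2 * \<alpha> k}" for k
  have K [measurable]: "K k \<in> sets borel" for k unfolding K_def by measurable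
  have T [measurable]: "T k \<in> sets borel" for k unfolding T_def by measurable
  have pointwise: "ennreal (f x powr q) \<le> (\<Sum>k. ennreal ((4 * \<alpha> k) powr q) * indicator (K k) x)" for x
  proof (cases "f x = 0")
    case False
    then have "0 < f x" by (simp add: f_def)
    then obtain k0 where "(1 / 2) ^ k0 < f x * 2 / U"
      using real_arch_pow_inv[of "f x * 2 / U" "1 / 2"] U(1) by auto
    then have k0: "U / 2 ^ k0 / 2 \<le> f x" using U(1) by (simp add: field_simps)
    define k where "k = (LEAST k. U / 2 ^ k / 2 \<le> f x)"
    have k: "U / 2 ^ k / 2 \<le> f x" unfolding k_def using k0 by (rule LeastI)
    have "f x \<le> U / 2 ^ k"
    proof (cases k)
      case (Suc j)
      then have "j < (LEAST k. U / 2 ^ k / 2 \<le> f x)" unfolding k_def[symmetric] by simp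
      then have "\<not> U / 2 ^ j / 2 \<le> f x" by (rule not_less_Least)
      then show ?thesis using Suc by simp
    qed (use U in simp)
    then have "ennreal (f x powr q) \<le> ennreal ((4 * \<alpha> k) powr q) * indicator (K k) x"
      using k q \<open>0 < f x\<close> by (auto simp: \<alpha>_def K_def intro!: ennreal_leI powr_mono2)
    also have "\<dots> \<le> (\<Sum>k. ennreal ((4 * \<alpha> k) powr q) * indicator (K k) x)"
      using sum_le_suminf[OF summableI, of "{k}" "\<lambda>k. ennreal ((4 * \<alpha> k) powr q) * indicator (K k) x"]
      by (simp only: sum.insert sum.empty finite.intros empty_iff not_False_eq_True add_0_right zero_le)
    finally show ?thesis .
  qed simp
  have level: "\<nu> (K k) \<le> ennreal ((8 * cap_const / \<alpha> k * G (T k)) powr q)" for k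
    unfolding K_def T_def G_def
    by (rule level_estimate[OF f ugf g inf \<alpha> upper(1) upper(2)]) (use \<alpha>[of k] in auto)
  have disj: "disjoint_family T"
    unfolding disjoint_family_on_def
  proof (intro ballI impI)
    have *: "T i \<inter> T j = {}" if "i < j" for i j
    proof -
      have "U / 2 ^ j \<le> U / 2 ^ Suc i"
        using that U by (intro divide_left_mono power_increasing) auto
      then have "3 / 2 * \<alpha> j < \<alpha> i" using \<alpha>[of i] by (simp add: \<alpha>_def)
      then show ?thesis by (auto simp: T_def)
    qed
    fix i j :: nat assume "i \<noteq> j"
    then show "T i \<inter> T j = {}" using *[of i j] *[of j i] by (cases "i < j") auto
  qed
  have "(\<integral>\<^sup>+ x. ennreal (\<bar>u x\<bar> powr q) \<partial>N) \<le>
      (\<integral>\<^sup>+ x. (\<Sum>k. ennreal ((4 * \<alpha> k) powr q) * indicator (K k) x) \<partial>N)"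
    using pointwise by (intro nn_integral_mono) (simp add: f_def)
  also have "\<dots> = (\<Sum>k. \<integral>\<^sup>+ x. ennreal ((4 * \<alpha> k) powr q) * indicator (K k) x \<partial>N)"
    using borel_sets_N[OF K] by (intro nn_integral_suminf) auto
  also have "\<dots> = (\<Sum>k. ennreal ((4 * \<alpha> k) powr q) * \<nu> (K k))"
    using borel_sets_N[OF K] emeasure_N[OF K] by (simp add: nn_integral_cmult_indicator)
  also have "\<dots> \<le> ennreal ((32 * cap_const * G UNIV) powr q)"
  proof (intro suminf_le_const summableI)
    fix n
    have "(\<Sum>k<n. ennreal ((4 * \<alpha> k) powr q) * \<nu> (K k)) \<le> (\<Sum>k<n. ennreal ((32 * cap_const * G (T k)) powr q))"
    proof (rule sum_mono)
      fix k
      have "ennreal ((4 * \<alpha> k) powr q) * \<nu> (K k) \<le>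
          ennreal ((4 * \<alpha> k) powr q) * ennreal ((8 * cap_const / \<alpha> k * G (T k)) powr q)"
        by (intro mult_left_mono level) simp
      also have "\<dots> = ennreal ((4 * \<alpha> k * (8 * cap_const / \<alpha> k * G (T k))) powr q)"
        using \<alpha>[of k] cap_const_nonneg by (subst powr_mult) (auto simp: G_def ennreal_mult)
      also have "4 * \<alpha> k * (8 * cap_const / \<alpha> k * G (T k)) = 32 * cap_const * G (T k)"
        using \<alpha>[of k] by (simp add: field_simps)
      finally show "ennreal ((4 * \<alpha> k) powr q) * \<nu> (K k) \<le> ennreal ((32 * cap_const * G (T k)) powr q)" .
    qed
    also have "\<dots> = ennreal (\<Sum>k<n. (32 * cap_const * G (T k)) powr q)" by (intro sum_ennreal) simp
    also have "\<dots> \<le> ennreal ((\<Sum>k<n. 32 * cap_const * G (T k)) powr q)"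
      using cap_const_nonneg q by (intro ennreal_leI sum_powr_le_powr_sum) (auto simp: G_def)
    also have "\<dots> \<le> ennreal ((32 * cap_const * G UNIV) powr q)"
    proof (intro ennreal_leI powr_mono2)
      have "(\<Sum>k<n. G (T k)) = G (\<Union>k<n. T k)"
        unfolding G_def using disj
        by (intro finite_measure.finite_measure_finite_Union[OF dens(1), symmetric])
          (auto intro!: borel_sets_M simp: disjoint_family_on_def)
      also have "\<dots> \<le> G UNIV"
        unfolding G_def by (intro finite_measure.finite_measure_mono[OF dens(1)]) (auto intro!: borel_sets_M)
      finally show "(\<Sum>k<n. 32 * cap_const * G (T k)) \<le> 32 * cap_const * G UNIV"
        unfolding sum_distrib_left[symmetric] using cap_const_nonneg by (intro mult_left_mono) auto
      show "0 \<le> (\<Sum>k<n. 32 * cap_const * G (T k))" using cap_const_nonneg by (intro sum_nonneg) (auto simp: G_def)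
    qed (use q in simp)
    finally show "(\<Sum>k<n. ennreal ((4 * \<alpha> k) powr q) * \<nu> (K k)) \<le> ennreal ((32 * cap_const * G UNIV) powr q)" .
  qed
  also have "G UNIV = enn2real (\<integral>\<^sup>+ x. g x \<partial>M)"
    using dens(2)[of UNIV] by (simp add: G_def)
  finally show ?thesis .
qed

text \<open>The constant function \<open>1\<close> is integrable and has upper gradient \<open>0\<close>, so all balls have zero
  capacity.\<close>
lemma \<nu>_null_if_finite:
  assumes "\<mu> UNIV < \<infinity>"
  shows "emeasure N UNIV = 0"
proof -
  have "cap1 \<mu> (ball x r) \<le> (\<integral>\<^sup>+ y. 0 \<partial>M)" for x r
  proof (rule cap1_le[OF regular])
    show "upper_gradient (\<lambda>x. ereal 1) (\<lambda>_. 0)" by (simp add: upper_gradient_real_iff)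
    show "(\<integral>\<^sup>+ y. ennreal \<bar>1::real\<bar> \<partial>M) < \<infinity>"
      using assms emeasure_M[of UNIV] sets.top[of M] by simp
  qed auto
  then have "\<nu> (ball x r) \<le> ennreal ((\<gamma> * 0) powr q)" if "0 < r" for x r
    using that by (intro \<nu>_ball_le) auto
  then have "ball x (real (Suc n)) \<in> null_sets N" for x n
    by (intro null_setsI borel_sets_N) (auto simp: emeasure_N)
  then have "(\<Union>n. ball x (real (Suc n))) \<in> null_sets N" for x by (intro null_sets_UN) auto
  moreover have "(\<Union>n. ball x (real (Suc n))) = UNIV" for x :: 'a
  proof -
    have "\<exists>n. y \<in> ball x (real (Suc n))" for y
    proof -
      obtain n where "dist x y < real n" using reals_Archimedean2 by blast
      then have "y \<in> ball x (real (Suc n))" by simp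
      then show ?thesis ..
    qed
    then show ?thesis by blast
  qed
  ultimately show ?thesis by (metis null_setsD1)
qed

lemma sobolev_inequality_upper_gradient:
  fixes u :: "'a \<Rightarrow> real"
  assumes u: "u \<in> C0" and ug: "upper_gradient (\<lambda>x. ereal (u x)) g"
  shows "ennpowr (\<integral>\<^sup>+ x. ennreal (\<bar>u x\<bar> powr q) \<partial>N) (1 / q)
    \<le> ennreal (32 * cap_const + 1) * (\<integral>\<^sup>+ x. g x \<partial>M)"
proof (cases "\<mu> UNIV = \<infinity>")
  case False
  have "AE x in N. ennreal (\<bar>u x\<bar> powr q) = 0"
    using \<nu>_null_if_finite False borel_sets_N[of UNIV]
    by (intro AE_I[where N=UNIV]) (auto simp: less_top)
  then have "(\<integral>\<^sup>+ x. ennreal (\<bar>u x\<bar> powr q) \<partial>N) = (\<integral>\<^sup>+ x. 0 \<partial>N)"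
    by (rule nn_integral_cong_AE)
  then show ?thesis by (simp add: ennpowr_def)
next
  case inf: True
  show ?thesis
  proof (cases "\<integral>\<^sup>+ x. g x \<partial>M")
    case (real I)
    have "ennpowr (\<integral>\<^sup>+ x. ennreal (\<bar>u x\<bar> powr q) \<partial>N) (1 / q) \<le> ennreal (32 * cap_const * I)"
      using capacitary_strong_type[OF u ug _ inf] real cap_const_nonneg q by (intro ennpowr_inverse_le) auto
    also have "\<dots> \<le> ennreal ((32 * cap_const + 1) * I)" using real by (intro ennreal_leI) (simp add: algebra_simps)
    also have "\<dots> = ennreal (32 * cap_const + 1) * ennreal I" using cap_const_nonneg real by (intro ennreal_mult) auto
    finally show ?thesis using real by simp
  next
    case top
    have "ennreal (32 * cap_const + 1) \<noteq> 0" using cap_const_nonneg by (simp add: ennreal_eq_0_iff not_le)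
    then show ?thesis unfolding top by (simp only: ennreal_mult_top if_False top_greatest)
  qed
qed

lemma sobolev_inequality:
  fixes u :: "'a \<Rightarrow> real"
  assumes u: "u \<in> C0" and g: "weak_upper_gradient \<mu> (\<lambda>x. ereal (u x)) g"
  shows "ennpowr (\<integral>\<^sup>+ x. ennreal (\<bar>u x\<bar> powr q) \<partial>N) (1 / q)
    \<le> ennreal (32 * cap_const + 1) * (\<integral>\<^sup>+ x. g x \<partial>M)"
proof (rule ennreal_le_epsilon)
  fix e :: real assume e: "0 < e"
  define c where "c = 32 * cap_const + 1"
  have c: "0 < c" using cap_const_nonneg by (simp add: c_def)
  obtain g' where g': "upper_gradient (\<lambda>x. ereal (u x)) g'"
    "(\<integral>\<^sup>+ x. g' x \<partial>M) \<le> (\<integral>\<^sup>+ x. g x \<partial>M) + ennreal (e / c)"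
    by (rule weak_upper_gradient_approx[OF regular ball_fin g, of "e / c"]) (use e c in auto)
  have "ennpowr (\<integral>\<^sup>+ x. ennreal (\<bar>u x\<bar> powr q) \<partial>N) (1 / q) \<le> ennreal c * (\<integral>\<^sup>+ x. g' x \<partial>M)"
    unfolding c_def by (rule sobolev_inequality_upper_gradient[OF u g'(1)])
  also have "\<dots> \<le> ennreal c * ((\<integral>\<^sup>+ x. g x \<partial>M) + ennreal (e / c))"
    by (intro mult_left_mono g'(2)) simp
  also have "\<dots> = ennreal c * (\<integral>\<^sup>+ x. g x \<partial>M) + ennreal e"
    using c e by (simp add: distrib_left ennreal_mult[symmetric])
  finally show "ennpowr (\<integral>\<^sup>+ x. ennreal (\<bar>u x\<bar> powr q) \<partial>N) (1 / q)
    \<le> ennreal (32 * cap_const + 1) * (\<integral>\<^sup>+ x. g x \<partial>M) + ennreal e" by (simp only: c_def)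
qed

end

theorem theorem3p8:
  fixes \<mu> \<nu> :: "'a::complete_space set \<Rightarrow> ennreal" and q \<gamma> :: real
  assumes "borel_regular \<mu>"
    and "\<And>x r. 0 < r \<Longrightarrow> 0 < \<mu> (ball x r) \<and> \<mu> (ball x r) < \<infinity>"
    and "doubling \<mu>"
    and "weak_11_Poincare \<mu>"
    and "borel_regular \<nu>"
    and "1 \<le> q"
    and "0 \<le> \<gamma>"
    and "\<And>x r. 0 < r \<Longrightarrow> ennpowr (\<nu> (ball x r)) (1 / q) \<le> ennreal \<gamma> * cap1 \<mu> (ball x r)"
  shows "\<exists>cS::real. 0 < cS \<and>
    (\<forall>u g. u \<in> C0 \<longrightarrow> (\<lambda>x. ereal (u x)) \<in> N11 \<mu> \<longrightarrow>
       weak_upper_gradient \<mu> (\<lambda>x. ereal (u x)) g \<longrightarrow>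
       ennpowr (\<integral>\<^sup>+ x. ennreal (\<bar>u x\<bar> powr q) \<partial>carath \<nu>) (1 / q)
         \<le> ennreal cS * (\<integral>\<^sup>+ x. g x \<partial>carath \<mu>))"
proof -
  from \<open>doubling \<mu>\<close> obtain cD :: real where cD: "1 \<le> cD"
    "\<And>x r. 0 < r \<Longrightarrow> \<mu> (ball x (2 * r)) \<le> ennreal cD * \<mu> (ball x r)"
    unfolding doubling_def by blast
  from \<open>weak_11_Poincare \<mu>\<close> obtain cp \<tau> :: real where "0 < cp" "1 \<le> \<tau>"
    "\<And>x r u g. 0 < r \<Longrightarrow> u \<in> L1 \<mu> \<Longrightarrow> upper_gradient u g \<Longrightarrow>
      (\<integral>\<^sup>+ y\<in>ball x r. e2ennreal \<bar>u y - ereal (mean_value \<mu> (ball x r) u)\<bar> \<partial>carath \<mu>) / \<mu> (ball x r)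
        \<le> ennreal (cp * r) * ((\<integral>\<^sup>+ y\<in>ball x (\<tau> * r). g y \<partial>carath \<mu>) / \<mu> (ball x (\<tau> * r)))"
    unfolding weak_11_Poincare_def by blast
  then interpret capacitary_measure \<mu> cD cp \<tau> \<nu> q \<gamma>
    using assms cD by unfold_locales auto
  have "0 < 32 * cap_const + 1" using cap_const_nonneg by simp
  then show ?thesis using sobolev_inequality by blast
qed

end
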